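(* Let $1<k\le n$ and let $\|\cdot\|_{(k)}$ be the Ky-Fan $k$-norm on $\mathbb{M}_n(\mathbb{C})$. Assume $T\colon\mathbb{M}_n(\mathbb{C})\to\mathbb{M}_n(\mathbb{C})$ is a ($\mathbb{C}$-)linear bijection such that, for all $A,B\in\mathbb{M}_n(\mathbb{C})$, $\|A+B\|_{(k)}=\|A\|_{(k)}+\|B\|_{(k)}$ implies $\|T(A)+T(B)\|_{(k)}=\|T(A)\|_{(k)}+\|T(B)\|_{(k)}$. Then $T$ is a scalar multiple of a linear isometry of $(\mathbb{M}_n(\mathbb{C}),\|\cdot\|_{(k)})$, and hence there exist $\gamma>0$ and unitary $U,V\in\mathbb{M}_n(\mathbb{C})$ such that $T$ has the form $X\mapsto\gamma UXV$ or $X\mapsto\gamma UX^tV$.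
   Context: For $A\in\mathbb{M}_n(\mathbb{C})$ (complex $n\times n$ matrices), $s_1(A)\ge\cdots\ge s_n(A)$ are its singular values, and the Ky-Fan $k$-norm is $\|A\|_{(k)}=s_1(A)+\cdots+s_k(A)$. $X^t$ is the transpose of $X$. *)

theory Defs
  imports "HOL-Analysis.Analysis" "HOL-Computational_Algebra.Computational_Algebra"
begin

text \<open>
  \<open>M_n(\<complex>)\<close> is the type \<open>complex^'n^'n\<close>, with \<open>n = CARD('n)\<close>.  The library's \<open>(*s)\<close> scales vectors
  by entries of the same type as their components, and \<open>(*\<^sub>R)\<close> only allows real scalars, so
  complex scaling of matrices is introduced here.
\<close>

definition cscale :: "complex \<Rightarrow> complex^'n^'m \<Rightarrow> complex^'n^'m" (infixr "*\<^sub>C" 75)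
  where "c *\<^sub>C A = (\<chi> i j. c * A $ i $ j)"

lemma vector_space_cscale: "vector_space (cscale :: complex \<Rightarrow> complex^'n^'m \<Rightarrow> complex^'n^'m)"
  by unfold_locales (simp_all add: cscale_def vec_eq_iff algebra_simps)

abbreviation clinear :: "(complex^'n^'m \<Rightarrow> complex^'q^'p) \<Rightarrow> bool"
  where "clinear \<equiv> Vector_Spaces.linear cscale cscale"

definition conj_transpose :: "complex^'n^'m \<Rightarrow> complex^'m^'n"
  where "conj_transpose A = (\<chi> i j. cnj (A $ j $ i))"

definition unitary_matrix :: "complex^'n^'n \<Rightarrow> bool"
  where "unitary_matrix U \<longleftrightarrow>
    conj_transpose U ** U = mat 1 \<and> U ** conj_transpose U = mat 1"

definition charpoly :: "'a::comm_ring_1^'n^'n \<Rightarrow> 'a poly"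
  where "charpoly A = det (mat [:0, 1:] - (\<chi> i j. [:A $ i $ j:]))"

text \<open>
  The singular values of \<open>A\<close> are the square roots of the eigenvalues of \<open>A\<^sup>* A\<close>, repeated according
  to multiplicity and listed in decreasing order.  These eigenvalues are real and nonnegative, so
  \<open>Re\<close> merely converts them to type \<open>real\<close>.
\<close>

definition singular_values :: "complex^'n^'n \<Rightarrow> real list"
  where "singular_values A = rev (sorted_list_of_multiset
    (image_mset (\<lambda>z. sqrt (Re z)) (proots (charpoly (conj_transpose A ** A)))))"

text \<open>Indices start at 1, as in \<open>s_1(A) \<ge> \<dots> \<ge> s_n(A)\<close>; they are meaningful for \<open>1 \<le> i \<le> CARD('n)\<close>.\<close>

definition singular_value :: "nat \<Rightarrow> complex^'n^'n \<Rightarrow> real"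
  where "singular_value i A = singular_values A ! (i - 1)"

definition ky_fan_norm :: "nat \<Rightarrow> complex^'n^'n \<Rightarrow> real"
  where "ky_fan_norm k A = (\<Sum>i = 1..k. singular_value i A)"

definition ky_fan_linear_isometry :: "nat \<Rightarrow> (complex^'n^'n \<Rightarrow> complex^'n^'n) \<Rightarrow> bool"
  where "ky_fan_linear_isometry k S \<longleftrightarrow>
    clinear S \<and> (\<forall>X. ky_fan_norm k (S X) = ky_fan_norm k X)"

end

theory Submission
  imports Defs
begin

text \<open>
  The Ky Fan norm \<open>N(A)\<close> is the maximum of \<open>Re tr(P U A V)\<close> over unitary \<open>U\<close>, \<open>V\<close>, where \<open>P\<close> is a fixed
  coordinate projection of rank \<open>k\<close>, and \<open>N(A + B) = N(A) + N(B)\<close> means that one pair \<open>(U, V)\<close>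
  is a maximiser for both \<open>A\<close> and \<open>B\<close>.  At a maximiser \<open>M = U A V\<close> commutes with \<open>P\<close> and \<open>M P\<close> is
  positive semidefinite.

  Suppose \<open>N(A + t B) = N(A) + N(B)\<close> for all phases \<open>t\<close>.  With \<open>M = U A V\<close> and \<open>L = t U B V\<close> a
  common pair of maximisers, every nonzero eigenvalue of \<open>(M P)(L P)\<close> is positive and an eigenvalue
  of \<open>t A\<^sup>*B\<close>; as \<open>A\<^sup>*B\<close> has finitely many eigenvalues, a suitable \<open>t\<close> forces \<open>(M P)(L P) = 0\<close>.  Hence \<open>M P\<close> is
  singular on the range of \<open>P\<close>, maximality gives \<open>M = M P\<close>, likewise \<open>L = L P\<close>, and \<open>A\<close>, \<open>B\<close> are
  orthogonal with ranks adding up to at most \<open>k\<close>.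

  For unitary \<open>X\<close>, \<open>Y\<close> the matrices \<open>X E\<^sub>p\<^sub>p Y\<close> with \<open>p\<close> in a \<open>k\<close>-element set are additive for all phases,
  hence so are their images under \<open>T\<close>: these are \<open>k\<close> nonzero, pairwise orthogonal matrices of
  total rank at most \<open>k\<close>, so each has rank one.  Thus \<open>T\<close> preserves rank one matrices and their
  orthogonality.  After composing with unitaries \<open>T(E\<^sub>i\<^sub>i)\<close> is a multiple of \<open>E\<^sub>i\<^sub>i\<close>, and then, up to
  transposition, \<open>T\<close> is an entrywise multiplication; orthogonality makes its coefficients equal in
  modulus, and the rank of the image of the all-ones matrix makes them a product \<open>\<alpha>\<^sub>i \<beta>\<^sub>j\<close>.
\<close>

no_notation fps_nth (infixl \<open>$\<close> 75)

section \<open>Algebra of complex matrices, adjoints and the Hermitian inner product\<close>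

abbreviation adj :: "complex^'n^'m \<Rightarrow> complex^'m^'n"
  where "adj \<equiv> conj_transpose"

definition cdot :: "complex^'n \<Rightarrow> complex^'n \<Rightarrow> complex"
  where "cdot u v = (\<Sum>i\<in>UNIV. cnj (u $ i) * v $ i)"

text \<open>This is the matrix u v^* of the map sending x to <v, x> u; the inner product
  \<open>cdot\<close> is conjugate-linear in its first argument.\<close>

definition outer :: "complex^'m \<Rightarrow> complex^'n \<Rightarrow> complex^'n^'m"
  where "outer u v = (\<chi> i j. u $ i * cnj (v $ j))"

definition diagm :: "('n \<Rightarrow> complex) \<Rightarrow> complex^'n^'n"
  where "diagm d = (\<chi> i j. if i = j then d i else 0)"

abbreviation proj :: "'n set \<Rightarrow> complex^'n^'n"
  where "proj K \<equiv> diagm (indicator K)"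

text \<open>Over the complex numbers, reality of the quadratic form already makes \<open>G\<close>
  Hermitian; see \<open>psd_adj\<close>.\<close>

definition psd :: "complex^'n^'n \<Rightarrow> bool"
  where "psd G \<longleftrightarrow> (\<forall>v. Im (cdot v (G *v v)) = 0 \<and> Re (cdot v (G *v v)) \<ge> 0)"

lemma matrix_add_rdistrib: "(A + B) ** C = A ** C + B ** (C :: 'a::semiring_1^'n^'m)"
  by (simp add: vec_eq_iff matrix_matrix_mult_def distrib_right sum.distrib)

lemma matrix_diff_ldistrib: "A ** (B - C) = A ** B - A ** (C :: 'a::ring_1^'n^'m)"
  by (simp add: vec_eq_iff matrix_matrix_mult_def right_diff_distrib sum_subtractf)

lemma matrix_diff_rdistrib: "(A - B) ** C = A ** C - B ** (C :: 'a::ring_1^'n^'m)"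
  by (simp add: vec_eq_iff matrix_matrix_mult_def left_diff_distrib sum_subtractf)

lemma matrix_mult_zero [simp]: "(A :: 'a::semiring_1^'m^'l) ** (0 :: 'a^'n^'m) = 0" "(0 :: 'a^'m^'l) ** (B :: 'a^'n^'m) = 0"
  by (simp_all add: vec_eq_iff matrix_matrix_mult_def)

lemma cscale_component [simp]: "(c *\<^sub>C A) $ i $ j = c * A $ i $ j"
  by (simp add: cscale_def)

lemma cscale_simps [simp]: "1 *\<^sub>C A = A" "0 *\<^sub>C A = 0" "c *\<^sub>C 0 = 0" "a *\<^sub>C b *\<^sub>C A = (a * b) *\<^sub>C A"
  by (simp_all add: vec_eq_iff)

lemma cscale_distrib:
  "c *\<^sub>C (A + B) = c *\<^sub>C A + c *\<^sub>C B" "(c + d) *\<^sub>C A = c *\<^sub>C A + d *\<^sub>C A"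
  by (simp_all add: vec_eq_iff algebra_simps)

lemma scaleR_eq_cscale: "r *\<^sub>R (A :: complex^'n^'m) = of_real r *\<^sub>C A"
  by (simp add: vec_eq_iff) (simp add: scaleR_conv_of_real)

lemma matrix_mult_cscale [simp]: "A ** (c *\<^sub>C B) = c *\<^sub>C (A ** B)" "(c *\<^sub>C A) ** B = c *\<^sub>C (A ** B)"
  by (simp_all add: vec_eq_iff matrix_matrix_mult_def sum_distrib_left algebra_simps)

lemma adj_component [simp]: "adj A $ i $ j = cnj (A $ j $ i)"
  by (simp add: conj_transpose_def)

lemma adj_simps [simp]: "adj (adj A) = A" "adj (mat 1) = mat 1" "adj 0 = 0"
  "adj (A + B) = adj A + adj B" "adj (A - B) = adj A - adj B"
  "adj (c *\<^sub>C A) = cnj c *\<^sub>C adj A" "adj (outer u v) = outer v u"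
  "adj (diagm d) = diagm (\<lambda>i. cnj (d i))"
  by (auto simp: vec_eq_iff mat_def outer_def diagm_def)

lemma adj_mult: "adj (A ** B) = adj B ** adj A"
  by (simp add: vec_eq_iff matrix_matrix_mult_def mult.commute)

lemma diagm_component [simp]: "diagm d $ i $ j = (if i = j then d i else 0)"
  by (simp add: diagm_def)

lemma diagm_mult_component [simp]: "(diagm d ** A) $ i $ j = d i * A $ i $ j"
  by (simp add: matrix_matrix_mult_def if_distrib if_distribR cong: if_cong)

lemma mult_diagm_component [simp]: "(A ** diagm d) $ i $ j = A $ i $ j * d j"
  by (simp add: matrix_matrix_mult_def if_distrib if_distribR cong: if_cong)

lemma diagm_mult_diagm: "diagm d ** diagm e = diagm (\<lambda>i. d i * e i)"
  by (simp add: vec_eq_iff)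

lemma diagm_one: "diagm (\<lambda>_. 1) = mat 1"
  by (simp add: vec_eq_iff mat_def)

lemma diagm_mult_vec_component [simp]: "(diagm d *v v) $ i = d i * v $ i"
  by (simp add: matrix_vector_mult_def if_distrib if_distribR cong: if_cong)

lemma outer_component [simp]: "outer u v $ i $ j = u $ i * cnj (v $ j)"
  by (simp add: outer_def)

lemma outer_zero [simp]: "outer 0 v = 0" "outer u 0 = 0"
  by (simp_all add: vec_eq_iff)

lemma outer_diff: "outer (u - v) w = outer u w - outer v w" "outer w (u - v) = outer w u - outer w v"
  by (simp_all add: vec_eq_iff algebra_simps)

lemma outer_mult_outer: "outer u v ** outer x y = cdot v x *\<^sub>C outer u y"
  by (simp add: vec_eq_iff matrix_matrix_mult_def cdot_def sum_distrib_left sum_distrib_right mult_ac)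

lemma mult_outer: "A ** outer u v = outer (A *v u) v"
  by (simp add: vec_eq_iff matrix_matrix_mult_def matrix_vector_mult_def sum_distrib_left mult_ac)

lemma outer_mult: "outer u v ** A = outer u (adj A *v v)"
  by (simp add: vec_eq_iff matrix_matrix_mult_def matrix_vector_mult_def sum_distrib_left mult_ac)

lemma outer_mult_vec: "outer u v *v x = cdot v x *s u"
  by (simp add: vec_eq_iff matrix_vector_mult_def cdot_def sum_distrib_right sum_distrib_left mult_ac)

lemma cscale_mult_vec: "(c *\<^sub>C A) *v v = c *s (A *v v)"
  by (simp add: vec_eq_iff matrix_vector_mult_def sum_distrib_left mult.assoc)

lemma trace_outer: "trace (outer u v) = cdot v u"
  by (simp add: trace_def cdot_def mult.commute)

lemma trace_mult_outer: "trace (A ** outer u v) = cdot v (A *v u)"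
  by (simp add: mult_outer trace_outer)

lemma trace_cscale [simp]: "trace (c *\<^sub>C A) = c * trace A"
  by (simp add: trace_def sum_distrib_left)

lemma cdot_simps [simp]: "cdot 0 v = 0" "cdot v 0 = 0"
  "cdot u (c *s v) = c * cdot u v" "cdot (c *s u) v = cnj c * cdot u v"
  by (simp_all add: cdot_def sum_distrib_left mult_ac)

lemma cdot_distrib: "cdot u (v + w) = cdot u v + cdot u w" "cdot u (v - w) = cdot u v - cdot u w"
  "cdot (u + v) w = cdot u w + cdot v w" "cdot (u - v) w = cdot u w - cdot v w"
  by (simp_all add: cdot_def sum.distrib sum_subtractf algebra_simps)

lemma cnj_cdot: "cnj (cdot u v) = cdot v u"
  by (simp add: cdot_def mult.commute)

lemma cdot_adj: "cdot u (A *v v) = cdot (adj A *v u) v"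
proof -
  have "cdot u (A *v v) = (\<Sum>i\<in>UNIV. \<Sum>j\<in>UNIV. cnj (u $ i) * A $ i $ j * v $ j)"
    by (simp add: cdot_def matrix_vector_mult_def sum_distrib_left mult.assoc)
  also have "\<dots> = (\<Sum>j\<in>UNIV. \<Sum>i\<in>UNIV. cnj (u $ i) * A $ i $ j * v $ j)"
    by (rule sum.swap)
  also have "\<dots> = cdot (adj A *v u) v"
    by (simp add: cdot_def matrix_vector_mult_def sum_distrib_right sum_distrib_left mult_ac)
  finally show ?thesis .
qed

lemma cdot_self: "cdot v v = of_real (\<Sum>i\<in>UNIV. (cmod (v $ i))\<^sup>2)"
  unfolding cdot_def of_real_sum by (intro sum.cong refl) (metis complex_norm_square mult.commute of_real_power)

lemma cdot_self_eq_0_iff [simp]: "cdot v v = 0 \<longleftrightarrow> v = 0"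
proof -
  have "cdot v v = 0 \<longleftrightarrow> (\<Sum>i\<in>UNIV. (cmod (v $ i))\<^sup>2) = 0"
    by (simp only: cdot_self of_real_eq_0_iff)
  then show ?thesis by (simp add: sum_nonneg_eq_0_iff vec_eq_iff)
qed

lemma cdot_self_real: "Im (cdot v v) = 0" "Re (cdot v v) \<ge> 0" "v \<noteq> 0 \<Longrightarrow> Re (cdot v v) > 0"
proof -
  show "Im (cdot v v) = 0" by (simp add: cdot_self)
  show nonneg: "Re (cdot v v) \<ge> 0" by (simp add: cdot_self sum_nonneg)
  show "Re (cdot v v) > 0" if "v \<noteq> 0"
  proof -
    have "cdot v v \<noteq> 0" using that by simp
    with \<open>Im (cdot v v) = 0\<close> have "Re (cdot v v) \<noteq> 0" by (simp add: complex_eq_iff)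
    with nonneg show ?thesis by linarith
  qed
qed

lemma vec_smult_mult: "A *v (c *s v) = c *s (A *v (v :: complex^'n))"
  by (simp add: vec_eq_iff matrix_vector_mult_def sum_distrib_left mult_ac)

lemma cdot_axis [simp]: "cdot (axis i 1) v = v $ i" "cdot v (axis i 1) = cnj (v $ i)"
  by (simp_all add: cdot_def axis_def if_distrib if_distribR cong: if_cong)

lemma mult_vec_axis: "(A *v axis j 1) $ i = (A :: complex^'n^'m) $ i $ j"
  by (simp add: matrix_vector_mult_def axis_def if_distrib if_distribR cong: if_cong)

text \<open>Because <v, A^* A v> = |A v|^2, vanishing of A^* A forces A v = 0 for every v.\<close>

lemma adj_mult_self_eq_0:
  assumes "adj A ** A = 0"
  shows "A = 0"
proof -
  have "A *v v = 0" for v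
    using assms by (metis adj_simps(1) cdot_adj cdot_self_eq_0_iff matrix_vector_mul_assoc matrix_vector_mult_0 cdot_simps(2))
  then show ?thesis by (metis matrix_eq matrix_vector_mult_0)
qed

section \<open>Unitary matrices\<close>

lemma unitary_iff: "unitary_matrix U \<longleftrightarrow> adj U ** U = mat 1"
  unfolding unitary_matrix_def using matrix_left_right_inverse by blast

lemma unitary_cancel:
  assumes "unitary_matrix U"
  shows "adj U ** U = mat 1" "U ** adj U = mat 1"
    "adj U ** (U ** A) = A" "U ** (adj U ** A) = A" "A ** U ** adj U = A" "A ** adj U ** U = A"
    "adj U *v (U *v x) = x" "U *v (adj U *v x) = x"
  using assms
  by (simp_all add: unitary_matrix_def matrix_mul_assoc matrix_vector_mul_assoc)
     (simp_all add: matrix_mul_assoc [symmetric])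

lemma unitary_mat_1 [simp]: "unitary_matrix (mat 1)"
  by (simp add: unitary_matrix_def)

lemma unitary_adj [simp]: "unitary_matrix (adj U) \<longleftrightarrow> unitary_matrix U"
  by (auto simp: unitary_matrix_def)

lemma unitary_mult: "unitary_matrix U \<Longrightarrow> unitary_matrix V \<Longrightarrow> unitary_matrix (U ** V)"
  by (simp add: unitary_iff adj_mult) (metis matrix_mul_assoc matrix_mul_lid)

lemma unitary_transpose:
  assumes "unitary_matrix U"
  shows "unitary_matrix (transpose U)"
proof -
  have "adj (transpose U) ** transpose U = transpose (U ** adj U)"
    by (simp add: matrix_transpose_mul) (simp add: vec_eq_iff matrix_matrix_mult_def transpose_def)
  then show ?thesis using assms by (simp add: unitary_iff unitary_cancel)
qed

lemma unitary_diagm: "(\<And>i. cmod (d i) = 1) \<Longrightarrow> unitary_matrix (diagm d)"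
  by (simp add: unitary_iff diagm_mult_diagm diagm_one [symmetric] mult.commute complex_norm_square [symmetric]
      del: diagm_mult_component mult_diagm_component)

lemma unitary_eq_0_iff:
  fixes A :: "complex^'n^'n"
  assumes "unitary_matrix U" "unitary_matrix V"
  shows "U ** A ** V = 0 \<longleftrightarrow> A = 0"
proof
  assume "U ** A ** V = 0"
  then have "U ** A = 0 ** adj V" using unitary_cancel(5) [OF assms(2), of "U ** A"] by simp
  then show "A = 0" using unitary_cancel(3) [OF assms(1), of A] by simp
qed simp

lemma cdot_unitary: "unitary_matrix U \<Longrightarrow> cdot (U *v x) (U *v y) = cdot x y"
  by (simp add: cdot_adj unitary_cancel matrix_vector_mul_assoc)

text \<open>For \<open>|t| = 1\<close> this is the unitary matrix acting as the phase \<open>t\<close> on \<open>v\<close> and as the identity on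
  the orthogonal complement of \<open>v\<close>; it is the identity for \<open>v = 0\<close>, since then \<open>(t - 1) / 0 = 0\<close>.\<close>

definition phase_refl :: "complex^'n \<Rightarrow> complex \<Rightarrow> complex^'n^'n"
  where "phase_refl v t = mat 1 + ((t - 1) / cdot v v) *\<^sub>C outer v v"

text \<open>For nonzero v with n = <v, v>, the matrix 1 + c v v^* is unitary exactly when c + cnj c
  + |c|^2 n = 0, and for c = (t - 1) / n this equation says |t| = 1.\<close>

lemma unitary_phase_refl:
  assumes t: "cmod t = 1"
  shows "unitary_matrix (phase_refl v t)"
proof (cases "v = 0")
  case True
  then show ?thesis by (simp add: phase_refl_def)
next
  case False
  define n where "n = cdot v v"
  have n: "n \<noteq> 0" "cnj n = n" using False by (simp_all add: n_def cnj_cdot)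
  define c where "c = (t - 1) / n"
  have "t * cnj t = 1" using t by (metis complex_norm_square of_real_1 one_power2)
  then have *: "c + cnj c + cnj c * c * n = 0"
    using n by (simp add: c_def field_simps)
  have "adj (phase_refl v t) ** phase_refl v t = mat 1 + (c + cnj c + cnj c * c * n) *\<^sub>C outer v v"
    by (simp add: phase_refl_def c_def [symmetric] n_def [symmetric] outer_mult_outer matrix_add_ldistrib
      matrix_add_rdistrib cscale_distrib add_ac mult_ac)
  then show ?thesis by (simp add: * unitary_iff)
qed

lemma phase_refl_fix: "cdot v x = 0 \<Longrightarrow> phase_refl v t *v x = x"
  by (simp add: phase_refl_def matrix_vector_mult_add_rdistrib cscale_mult_vec outer_mult_vec)

text \<open>The orthonormality relations of the columns are closed conditions, and they bound every
  entry by 1 in modulus.\<close>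

lemma compact_unitary: "compact {U :: complex^'n^'n. unitary_matrix U}"
proof (rule compact_eq_bounded_closed [THEN iffD2], intro conjI)
  have *: "{U :: complex^'n^'n. unitary_matrix U} = 
      {U. \<forall>i j. (\<Sum>k\<in>UNIV. cnj (U $ k $ i) * U $ k $ j) = (if i = j then 1 else 0)}"
    by (auto simp: unitary_iff vec_eq_iff matrix_matrix_mult_def mat_def)
  show "closed {U :: complex^'n^'n. unitary_matrix U}"
    unfolding * by (intro closed_Collect_all closed_Collect_eq continuous_intros)
  have le: "cmod (U $ k $ j) \<le> 1" if "unitary_matrix U" for U :: "complex^'n^'n" and k j
  proof -
    have "(adj U ** U) $ j $ j = 1" using that by (simp add: unitary_iff mat_def)
    then have "of_real (\<Sum>k\<in>UNIV. (cmod (U $ k $ j))\<^sup>2) = (1 :: complex)"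
      by (simp add: matrix_matrix_mult_def complex_norm_square mult.commute del: of_real_power)
    then have s: "(\<Sum>k\<in>UNIV. (cmod (U $ k $ j))\<^sup>2) = 1" by (metis of_real_eq_1_iff)
    have "(cmod (U $ k $ j))\<^sup>2 \<le> (\<Sum>k\<in>UNIV. (cmod (U $ k $ j))\<^sup>2)"
      by (rule member_le_sum) auto
    with s show ?thesis using abs_square_le_1 [of "cmod (U $ k $ j)"] by simp
  qed
  have "norm U \<le> real CARD('n) * real CARD('n)" if "unitary_matrix U" for U :: "complex^'n^'n"
  proof -
    have "norm (U $ i) \<le> real CARD('n)" for i
    proof -
      have "norm (U $ i) \<le> (\<Sum>j\<in>UNIV. cmod (U $ i $ j))"
        unfolding norm_vec_def by (rule L2_set_le_sum) simp
      also have "\<dots> \<le> (\<Sum>j\<in>(UNIV :: 'n set). 1)"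
        by (intro sum_mono le that)
      finally show ?thesis by simp
    qed
    note row = this
    have "norm U \<le> (\<Sum>i\<in>UNIV. norm (U $ i))"
      unfolding norm_vec_def [of U] by (rule L2_set_le_sum) simp
    also have "\<dots> \<le> (\<Sum>i\<in>(UNIV :: 'n set). real CARD('n))"
      by (intro sum_mono row)
    finally show ?thesis by simp
  qed
  then show "bounded {U :: complex^'n^'n. unitary_matrix U}" by (auto simp: bounded_iff)
qed

section \<open>Diagonalisation by maximising a weighted trace\<close>

text \<open>Two kinds of weights matter: distinct positive ones, for which maximisers are diagonal,
  and the indicator of a \<open>k\<close>-element set, for which the maximum is the Ky Fan
  norm.\<close>

definition wtrace :: "('n \<Rightarrow> real) \<Rightarrow> complex^'n^'n \<Rightarrow> real"
  where "wtrace w M = (\<Sum>i\<in>UNIV. w i * Re (M $ i $ i))"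

definition wmaximal :: "('n \<Rightarrow> real) \<Rightarrow> complex^'n^'n \<Rightarrow> bool"
  where "wmaximal w M \<longleftrightarrow>
    (\<forall>U V. unitary_matrix U \<longrightarrow> unitary_matrix V \<longrightarrow> wtrace w (U ** M ** V) \<le> wtrace w M)"

lemma wtrace_trace: "wtrace w M = Re (trace (diagm (\<lambda>i. of_real (w i)) ** M))"
  by (simp add: wtrace_def trace_def)

lemma wtrace_linear: "wtrace w (A + B) = wtrace w A + wtrace w B"
  by (simp add: wtrace_def sum.distrib algebra_simps)

lemma continuous_wtrace [continuous_intros]:
  "continuous_on S f \<Longrightarrow> continuous_on S (\<lambda>x. wtrace w (f x))"
  unfolding wtrace_def by (intro continuous_intros)

lemma continuous_matrix_mult [continuous_intros]:
  fixes f :: "'a::topological_space \<Rightarrow> complex^'n^'m" and g :: "'a \<Rightarrow> complex^'l^'n"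
  shows "continuous_on S f \<Longrightarrow> continuous_on S g \<Longrightarrow> continuous_on S (\<lambda>x. f x ** g x)"
  unfolding matrix_matrix_mult_def by (intro continuous_intros)

lemma continuous_adj [continuous_intros]:
  fixes f :: "'a::topological_space \<Rightarrow> complex^'n^'m"
  shows "continuous_on S f \<Longrightarrow> continuous_on S (\<lambda>x. adj (f x))"
  unfolding conj_transpose_def by (intro continuous_intros)

text \<open>A maximising pair exists by compactness. It yields maximality in the sense of
  \<open>wmaximal\<close> because further unitary factors can be absorbed into the pair.\<close>

lemma wmaximal_exists:
  fixes A :: "complex^'n^'n"
  obtains U V where "unitary_matrix U" "unitary_matrix V" "wmaximal w (U ** A ** V)"
proof -
  let ?S = "{U :: complex^'n^'n. unitary_matrix U}"
  have "\<exists>p\<in>?S \<times> ?S. \<forall>q\<in>?S \<times> ?S. wtrace w (fst q ** A ** snd q) \<le> wtrace w (fst p ** A ** snd p)"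
    by (intro continuous_attains_sup compact_Times compact_unitary continuous_intros)
       (auto intro: unitary_mat_1)
  then obtain U V where U: "unitary_matrix U" and V: "unitary_matrix V"
    and max: "\<And>U' V'. unitary_matrix U' \<Longrightarrow> unitary_matrix V' \<Longrightarrow>
      wtrace w (U' ** A ** V') \<le> wtrace w (U ** A ** V)"
    by auto
  have "wmaximal w (U ** A ** V)"
    unfolding wmaximal_def
  proof (intro allI impI)
    fix U' V' :: "complex^'n^'n"
    assume "unitary_matrix U'" "unitary_matrix V'"
    then have "wtrace w ((U' ** U) ** A ** (V ** V')) \<le> wtrace w (U ** A ** V)"
      using U V by (intro max unitary_mult)
    then show "wtrace w (U' ** (U ** A ** V) ** V') \<le> wtrace w (U ** A ** V)"
      by (simp add: matrix_mul_assoc)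
  qed
  with U V that show ?thesis by blast
qed

lemma linear_le_quadratic_imp_zero:
  fixes p q :: real
  assumes "\<And>x. x * p \<le> x\<^sup>2 * q"
  shows "p = 0"
proof (rule ccontr)
  assume "p \<noteq> 0"
  \<comment> \<open>Any positive \<open>d\<close> exceeding \<open>q\<close> works: testing at x = p
    / d turns the hypothesis into d \<le> q.\<close>
  define d where "d = 2 * (\<bar>q\<bar> + 1)"
  have d: "d > 0" by (simp add: d_def)
  have "(p / d) * p \<le> (p / d)\<^sup>2 * q" by (rule assms)
  then have "p\<^sup>2 * d \<le> p\<^sup>2 * q"
    using d by (simp add: field_simps power2_eq_square)
  then have "d \<le> q" using \<open>p \<noteq> 0\<close> by simp
  then show False by (simp add: d_def)
qed

text \<open>The points \<open>(1 + \<i> x)\<^sup>2 / (1 + x\<^sup>2)\<close> of the unit circle turn a trigonometric inequality into a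
  polynomial one.\<close>

lemma circle_ineq:
  assumes "\<And>t. cmod t = 1 \<Longrightarrow> Re ((t - 1) * a) + (cmod (t - 1))\<^sup>2 * b \<le> 0"
  shows "Im a = 0"
proof (rule linear_le_quadratic_imp_zero [where q = "Re a - 2 * b"])
  fix x :: real
  \<comment> \<open>The parameter is negated so that the linear term -2 y Im a gets the sign
    required by \<open>linear_le_quadratic_imp_zero\<close>.\<close>
  let ?y = "- x"
  define s where "s = 1 + ?y\<^sup>2"
  have s: "s > 0" by (simp add: s_def add_pos_nonneg)
  define t where "t = Complex ((1 - ?y\<^sup>2) / s) (2 * ?y / s)"
  have "(cmod t)\<^sup>2 = ((1 - ?y\<^sup>2)\<^sup>2 + (2 * ?y)\<^sup>2) / s\<^sup>2"
    by (simp add: t_def cmod_def power_divide add_divide_distrib)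
  also have "(1 - ?y\<^sup>2)\<^sup>2 + (2 * ?y)\<^sup>2 = s\<^sup>2"
    by (simp add: s_def power2_eq_square algebra_simps)
  finally have "(cmod t)\<^sup>2 = 1" using s by simp
  then have t1: "cmod t = 1" by (metis norm_ge_zero abs_square_eq_1 abs_of_nonneg)
  have re: "Re t - 1 = - 2 * ?y\<^sup>2 / s" and im: "Im t = 2 * ?y / s"
    using s by (simp_all add: t_def s_def field_simps)
  have "(cmod (t - 1))\<^sup>2 = (Re t - 1)\<^sup>2 + (Im t)\<^sup>2" by (simp add: cmod_power2)
  also have "\<dots> = 4 * ?y\<^sup>2 * s / s\<^sup>2"
    unfolding re im by (simp add: power_divide add_divide_distrib [symmetric] s_def)
       (simp add: power2_eq_square power4_eq_xxxx algebra_simps)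
  also have "\<dots> = 4 * ?y\<^sup>2 / s" using s by (simp add: power2_eq_square)
  finally have c: "(cmod (t - 1))\<^sup>2 = 4 * ?y\<^sup>2 / s" .
  have "(Re t - 1) * Re a - Im t * Im a + (cmod (t - 1))\<^sup>2 * b \<le> 0"
    using assms [OF t1] by simp
  then have "(- 2 * ?y\<^sup>2 * Re a - 2 * ?y * Im a + 4 * ?y\<^sup>2 * b) / s \<le> 0"
    unfolding re im c by (simp add: add_divide_distrib diff_divide_distrib)
  then have "- 2 * ?y\<^sup>2 * Re a - 2 * ?y * Im a + 4 * ?y\<^sup>2 * b \<le> 0"
    using s by (simp add: divide_le_0_iff)
  then show "x * Im a \<le> x\<^sup>2 * (Re a - 2 * b)" by (simp add: algebra_simps)
qed

text \<open>The hypothesis expresses that applying \<open>phase_refl v t\<close> to a maximiser does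
  not increase a trace. Letting t run through the circle removes the imaginary part by
  \<open>circle_ineq\<close>; t = -1 gives the sign of the real part.\<close>

lemma psd_if_phases:
  assumes "\<And>t v. cmod t = 1 \<Longrightarrow> v \<noteq> 0 \<Longrightarrow> Re ((t - 1) / cdot v v * cdot v (G *v v)) \<le> 0"
  shows "psd G"
  unfolding psd_def
proof (intro allI)
  fix v :: "complex^'a"
  show "Im (cdot v (G *v v)) = 0 \<and> 0 \<le> Re (cdot v (G *v v))"
  proof (cases "v = 0")
    case False
    define n where "n = Re (cdot v v)"
    have n: "n > 0" "cdot v v = of_real n"
      using cdot_self_real [of v] False by (simp_all add: n_def complex_eq_iff)
    have *: "Re ((t - 1) * cdot v (G *v v)) \<le> 0" if "cmod t = 1" for t
    proof -
      have "Re ((t - 1) * cdot v (G *v v)) / n \<le> 0"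
        using assms [OF that False] by (simp add: n(2))
      then show ?thesis using n(1) by (simp add: divide_le_0_iff)
    qed
    have "Im (cdot v (G *v v)) = 0"
      using * by (intro circle_ineq [where b = 0]) simp
    moreover have "Re (cdot v (G *v v)) \<ge> 0"
      using * [of "- 1"] by simp
    ultimately show ?thesis by blast
  qed simp
qed

text \<open>Multiplying \<open>M\<close> by \<open>phase_refl v t\<close> changes the weighted trace
  by exactly the quantity in \<open>psd_if_phases\<close>. A factor on the left tests
  \<open>M ** W\<close>, a factor on the right tests \<open>W ** M\<close>.\<close>

lemma wmaximal_psd:
  fixes M :: "complex^'n^'n"
  assumes "wmaximal w M"
  defines "W \<equiv> diagm (\<lambda>i. of_real (w i))"
  shows "psd (M ** W)" "psd (W ** M)"
proof -
  have "Re (trace (W ** (phase_refl v t ** M))) \<le> Re (trace (W ** M))" if "cmod t = 1" for v t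
    using assms(1) unitary_phase_refl [OF that, of v]
    unfolding wmaximal_def wtrace_trace W_def by (metis matrix_mul_rid unitary_mat_1)
  moreover have "trace (W ** (phase_refl v t ** M)) =
      trace (W ** M) + (t - 1) / cdot v v * cdot v ((M ** W) *v v)" for v t
  proof -
    have "trace (W ** (phase_refl v t ** M)) = trace ((M ** W) ** phase_refl v t)"
      by (metis matrix_mul_assoc trace_mul_sym)
    then show ?thesis
      by (simp add: phase_refl_def matrix_add_ldistrib trace_add trace_mult_outer
          trace_mul_sym [of M W])
  qed
  ultimately show "psd (M ** W)" by (intro psd_if_phases) auto
  have "Re (trace (W ** (M ** phase_refl v t))) \<le> Re (trace (W ** M))" if "cmod t = 1" for v t
    using assms(1) unitary_phase_refl [OF that, of v]
    unfolding wmaximal_def wtrace_trace W_def by (metis matrix_mul_lid unitary_mat_1)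
  moreover have "trace (W ** (M ** phase_refl v t)) =
      trace (W ** M) + (t - 1) / cdot v v * cdot v ((W ** M) *v v)" for v t
    by (simp add: phase_refl_def matrix_add_ldistrib trace_add trace_mult_outer matrix_mul_assoc)
  ultimately show "psd (W ** M)" by (intro psd_if_phases) auto
qed

text \<open>Polarisation: the vectors e_i + e_j and e_i + i e_j control the imaginary and the real
  part of the entries at (i, j) and (j, i).\<close>

lemma hermitian_if_real_form:
  fixes G :: "complex^'n^'n"
  assumes "\<And>v. Im (cdot v (G *v v)) = 0"
  shows "adj G = G"
proof -
  have exp: "cdot (u + v) (G *v (u + v)) = cdot u (G *v u) + cdot u (G *v v) + cdot v (G *v u) + cdot v (G *v v)" for u v
    by (simp add: matrix_vector_right_distrib cdot_distrib)
  have 1: "Im (cdot u (G *v v)) + Im (cdot v (G *v u)) = 0" for u v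
    using assms [of "u + v"] assms [of u] assms [of v] unfolding exp by simp
  have "cnj (G $ j $ i) = G $ i $ j" for i j
  proof -
    let ?e = "\<lambda>i. axis i 1 :: complex^'n"
    have "Im (G $ i $ j) + Im (G $ j $ i) = 0"
      using 1 [of "?e i" "?e j"] by (simp add: mult_vec_axis)
    moreover have "Re (G $ i $ j) - Re (G $ j $ i) = 0"
      using 1 [of "?e i" "\<i> *s ?e j"] by (simp add: mult_vec_axis vec_smult_mult)
    ultimately show ?thesis by (simp add: complex_eq_iff)
  qed
  then show ?thesis by (simp add: vec_eq_iff)
qed

lemma psd_adj: "psd G \<Longrightarrow> adj G = G"
  by (rule hermitian_if_real_form) (simp add: psd_def)

lemma psd_diag_entry:
  assumes "psd G"
  shows "Re (G $ i $ i) \<ge> 0" "Im (G $ i $ i) = 0"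
  using assms [unfolded psd_def, rule_format, of "axis i 1"] by (simp_all add: mult_vec_axis)

definition perm_matrix :: "('n \<Rightarrow> 'n) \<Rightarrow> complex^'n^'n"
  where "perm_matrix p = (\<chi> i j. if j = p i then 1 else 0)"

lemma mult_adj_perm_matrix: "(A ** adj (perm_matrix p)) $ i $ j = A $ i $ p j"
  by (simp add: perm_matrix_def matrix_matrix_mult_def if_distrib if_distribR cong: if_cong)

lemma unitary_perm_matrix:
  assumes "inj p"
  shows "unitary_matrix (perm_matrix p)"
proof -
  have "perm_matrix p ** adj (perm_matrix p) = mat 1"
    using assms by (simp add: vec_eq_iff mult_adj_perm_matrix) (auto simp: perm_matrix_def mat_def inj_eq)
  then show ?thesis
    unfolding unitary_matrix_def using matrix_left_right_inverse by blast
qed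

text \<open>The singular value decomposition comes from a maximiser of the weighted trace. Since
  \<open>M ** W\<close> and \<open>W ** M\<close> are both Hermitian, eliminating the entry at (j,
  i) gives (w_i^2 - w_j^2) M_ij = 0, and distinct positive weights make \<open>M\<close>
  diagonal.\<close>

lemma svd_sorted:
  fixes A :: "complex^'n^'n" and w :: "'n \<Rightarrow> real"
  assumes w: "inj w" "\<And>i. w i > 0"
  obtains U V s where "unitary_matrix U" "unitary_matrix V"
    "U ** A ** V = diagm (\<lambda>i. of_real (s i))" "\<And>i. s i \<ge> 0" "\<And>i j. w i > w j \<Longrightarrow> s i \<ge> (s j :: real)"
proof -
  obtain U V where UV: "unitary_matrix U" "unitary_matrix V" and max: "wmaximal w (U ** A ** V)"
    by (rule wmaximal_exists)
  define M where "M = U ** A ** V"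
  define s where "s i = Re (M $ i $ i)" for i
  note psd = wmaximal_psd [OF max, folded M_def]
  have 1: "w j * M $ i $ j = w i * cnj (M $ j $ i)" for i j
    using psd_adj [OF psd(1)] by (simp add: vec_eq_iff mult.commute)
  have 2: "w i * M $ i $ j = w j * cnj (M $ j $ i)" for i j
    using psd_adj [OF psd(2)] by (simp add: vec_eq_iff mult.commute)
  have off: "M $ i $ j = 0" if "i \<noteq> j" for i j
  proof -
    have "w i * (w i * M $ i $ j) = w j * (w j * M $ i $ j)"
      unfolding 1 [of j i] 2 [of i j] using 1 [of i j] by (simp add: mult.left_commute)
    then have "of_real ((w i)\<^sup>2 - (w j)\<^sup>2) * M $ i $ j = 0"
      by (simp add: algebra_simps power2_eq_square)
    moreover have "(w i)\<^sup>2 \<noteq> (w j)\<^sup>2"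
      using that w by (metis injD less_eq_real_def power2_eq_iff_nonneg)
    ultimately show ?thesis by (metis eq_iff_diff_eq_0 mult_eq_0_iff of_real_eq_0_iff)
  qed
  have diag: "M $ i $ i = of_real (s i)" "s i \<ge> 0" for i
  proof -
    have "w i * Re (M $ i $ i) \<ge> 0" "w i * Im (M $ i $ i) = 0"
      using psd_diag_entry [OF psd(2), of i] by simp_all
    then show "M $ i $ i = of_real (s i)" "s i \<ge> 0"
      using w(2) [of i] by (simp_all add: s_def complex_eq_iff zero_le_mult_iff)
  qed
  have M: "M = diagm (\<lambda>i. of_real (s i))"
    using off diag by (simp add: vec_eq_iff)
  have "s i \<ge> s j" if "w i > w j" for i j
  proof -
    \<comment> \<open>Swapping two diagonal entries by a permutation matrix changes the weighted
      trace by (w_i - w_j)(s_j - s_i), which maximality makes nonpositive.\<close>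
    define p where "p = Transposition.transpose i j"
    have "i \<noteq> j" using that by auto
    have p: "inj p" by (simp add: p_def)
    define R where "R = perm_matrix p"
    have R: "unitary_matrix R" unfolding R_def by (rule unitary_perm_matrix [OF p])
    have "(R ** M ** adj R) $ a $ a = of_real (s (p a))" for a
      by (simp add: M R_def mult_adj_perm_matrix) (simp add: perm_matrix_def)
    then have "wtrace w (R ** M ** adj R) = (\<Sum>a\<in>UNIV. w a * s (p a))"
      by (simp add: wtrace_def)
    moreover have "wtrace w (R ** M ** adj R) \<le> wtrace w M"
      using max R by (simp add: wmaximal_def M_def)
    ultimately have "(\<Sum>a\<in>UNIV. w a * s (p a)) \<le> (\<Sum>a\<in>UNIV. w a * s a)"
      by (simp add: wtrace_def s_def)
    then have "(\<Sum>a\<in>UNIV. w a * s (p a) - w a * s a) \<le> 0" by (simp add: sum_subtractf)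
    also have "(\<Sum>a\<in>UNIV. w a * s (p a) - w a * s a) = (\<Sum>a\<in>{i, j}. w a * s (p a) - w a * s a)"
      by (rule sum.mono_neutral_right) (auto simp: p_def transpose_def)
    finally have "(w i - w j) * (s j - s i) \<le> 0"
      using \<open>i \<noteq> j\<close> by (simp add: p_def algebra_simps)
    then show ?thesis using that by (simp add: mult_le_0_iff)
  qed
  with UV M diag(2) that show ?thesis unfolding M_def by blast
qed

section \<open>The Ky Fan norm as a maximum\<close>

lemma poly_charpoly: "poly (charpoly A) z = det (mat z - A)"
proof -
  have "poly ((mat [:0, 1:] - (\<chi> i j. [:A $ i $ j:])) $ i $ j) z = (mat z - A) $ i $ j" for i j
    by (simp add: mat_def)
  then show ?thesis
    unfolding charpoly_def det_def by (simp add: poly_sum poly_prod)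
qed

lemma charpoly_eqI:
  fixes A B :: "complex^'n^'n"
  shows "(\<And>z. det (mat z - A) = det (mat z - B)) \<Longrightarrow> charpoly A = charpoly B"
  by (intro poly_ext) (simp add: poly_charpoly)

lemma charpoly_unitary_conj:
  assumes "unitary_matrix U"
  shows "charpoly (adj U ** A ** U) = charpoly A"
proof (rule charpoly_eqI)
  fix z
  have z: "mat z = z *\<^sub>C (mat 1 :: complex^'a^'a)" by (simp add: vec_eq_iff mat_def)
  have "mat z - adj U ** A ** U = adj U ** (mat z - A) ** U"
    unfolding z using assms by (simp add: matrix_diff_ldistrib matrix_diff_rdistrib unitary_cancel)
  then have "det (mat z - adj U ** A ** U) = det (adj U) * det U * det (mat z - A)"
    by (simp add: det_mul)
  also have "det (adj U) * det U = det (adj U ** U)" by (simp add: det_mul)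
  finally show "det (mat z - adj U ** A ** U) = det (mat z - A)"
    using assms by (simp add: unitary_cancel)
qed

lemma charpoly_diagm: "charpoly (diagm d) = (\<Prod>i\<in>UNIV. [:- d i, 1:])"
proof (rule poly_ext)
  fix z
  have "det (mat z - diagm d) = (\<Prod>i\<in>UNIV. (mat z - diagm d) $ i $ i)"
    by (rule det_diagonal) (simp add: mat_def)
  then show "poly (charpoly (diagm d)) z = poly (\<Prod>i\<in>UNIV. [:- d i, 1:]) z"
    by (simp add: poly_charpoly poly_prod mat_def)
qed

lemma proots_charpoly_diagm: "proots (charpoly (diagm d)) = image_mset d (mset_set UNIV)"
proof -
  have "proots (charpoly (diagm d)) = (\<Sum>i\<in>UNIV. {#d i#})"
    unfolding charpoly_diagm by (subst proots_prod) auto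
  also have "\<dots> = image_mset d (mset_set UNIV)"
    by (simp add: sum_unfold_sum_mset)
  finally show ?thesis .
qed

text \<open>A^* A is unitarily similar to the diagonal matrix of the squares of the s_i, so its
  characteristic roots are these squares.\<close>

lemma singular_values_svd:
  fixes s :: "'n::finite \<Rightarrow> real"
  assumes "unitary_matrix U" "unitary_matrix V" "U ** A ** V = diagm (\<lambda>i. of_real (s i))" "\<And>i. s i \<ge> 0"
  shows "singular_values A = rev (sorted_list_of_multiset (image_mset s (mset_set UNIV)))"
proof -
  have A: "A = adj U ** diagm (\<lambda>i. of_real (s i)) ** adj V"
    unfolding assms(3) [symmetric] using assms(1,2) by (simp add: matrix_mul_assoc unitary_cancel)
  have "adj A ** A = adj (adj V) ** diagm (\<lambda>i. of_real ((s i)\<^sup>2)) ** adj V"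
    using assms(1) unfolding A
    by (simp add: adj_mult matrix_mul_assoc [symmetric] unitary_cancel)
       (simp add: matrix_mul_assoc diagm_mult_diagm power2_eq_square)
  then have "charpoly (adj A ** A) = charpoly (diagm (\<lambda>i. of_real ((s i)\<^sup>2)))"
    using assms(2) by (simp only: charpoly_unitary_conj unitary_adj)
  then have "proots (charpoly (adj A ** A)) = image_mset (\<lambda>i. of_real ((s i)\<^sup>2)) (mset_set UNIV)"
    by (simp add: proots_charpoly_diagm)
  then show ?thesis
    using assms(4) by (simp add: singular_values_def image_mset.compositionality o_def)
qed

text \<open>Allowing any \<open>k\<close>-element set \<open>K\<close> that carries the largest
  values avoids ordering the indices and covers ties. The increasing list of all values is the list
  for the complement of \<open>K\<close> followed by the list for \<open>K\<close>, so its reversal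
  starts with the values on \<open>K\<close>.\<close>

lemma ky_fan_norm_svd:
  fixes s :: "'n::finite \<Rightarrow> real" and A :: "complex^'n^'n"
  assumes A: "unitary_matrix U" "unitary_matrix V" "U ** A ** V = diagm (\<lambda>i. of_real (s i))" "\<And>i. s i \<ge> 0"
    and K: "card K = k" "\<And>i j. i \<in> K \<Longrightarrow> j \<notin> K \<Longrightarrow> s i \<ge> s j"
  shows "ky_fan_norm k A = (\<Sum>i\<in>K. s i)"
proof -
  define L where "L J = sorted_list_of_multiset (image_mset s (mset_set J))" for J
  have mset_L: "mset (L J) = image_mset s (mset_set J)" and sorted_L: "sorted (L J)" for J
    by (simp_all add: L_def)
  have set_L: "set (L J) = s ` J" for J
    using mset_L [of J] by (metis finite_set_mset_mset_set finite set_image_mset set_mset_mset)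
  have "mset (L UNIV) = mset (L (- K) @ L K)"
  proof -
    have "mset_set UNIV = mset_set (- K) + mset_set K"
      by (subst mset_set_Union [symmetric]) (auto simp: Compl_partition2)
    then show ?thesis by (simp add: mset_L)
  qed
  moreover have "sorted (L (- K) @ L K)"
    using K(2) by (auto simp: sorted_append sorted_L set_L)
  ultimately have "L UNIV = L (- K) @ L K"
    using sorted_L by (metis properties_for_sort)
  then have "singular_values A = rev (L K) @ rev (L (- K))"
    using singular_values_svd [OF A] by (simp add: L_def)
  moreover have len: "length (rev (L K)) = k"
    using K(1) mset_L [of K] by (metis length_rev size_image_mset size_mset size_mset_set)
  ultimately have "ky_fan_norm k A = (\<Sum>i = 1..k. rev (L K) ! (i - 1))"
    by (auto simp: ky_fan_norm_def singular_value_def nth_append intro!: sum.cong)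
  also have "\<dots> = (\<Sum>i<k. rev (L K) ! i)"
    by (rule sum.reindex_bij_witness [of _ Suc "\<lambda>i. i - 1"]) auto
  also have "\<dots> = sum_list (rev (L K))"
    by (simp add: sum_list_sum_nth len [symmetric] lessThan_atLeast0)
  also have "\<dots> = (\<Sum>i\<in>K. s i)"
    by (simp add: sum_mset_sum_list [symmetric] mset_L sum_unfold_sum_mset)
  finally show ?thesis .
qed

lemma ex_weight:
  fixes K :: "'n::finite set"
  obtains w :: "'n \<Rightarrow> real" where "inj w" "\<And>i. w i > 0" "\<And>i j. i \<in> K \<Longrightarrow> j \<notin> K \<Longrightarrow> w i > w j"
proof -
  obtain g :: "'n \<Rightarrow> nat" where g: "bij_betw g UNIV {0..<CARD('n)}"
    using ex_bij_betw_finite_nat [of "UNIV :: 'n set"] by auto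
  then have lt: "g i < CARD('n)" for i by (auto simp: bij_betw_def)
  \<comment> \<open>The numbering \<open>g\<close> takes values below CARD('n), so adding CARD('n)
    on \<open>K\<close> lifts these weights above all others while keeping them distinct; the final
    1 makes them positive.\<close>
  define w where "w i = (if i \<in> K then CARD('n) else 0) + g i + 1" for i
  have "inj w"
  proof (rule injI)
    fix i j assume "w i = w j"
    then have "g i = g j" using lt [of i] lt [of j] by (auto simp: w_def split: if_splits)
    then show "i = j" using g by (auto simp: bij_betw_def dest: injD)
  qed
  then have "inj (\<lambda>i. real (w i))" by (simp add: inj_def)
  moreover have "w i > 0" for i by (simp add: w_def)
  moreover have "w i > w j" if "i \<in> K" "j \<notin> K" for i j
    using that lt [of j] by (simp add: w_def)
  ultimately show ?thesis using that [of "\<lambda>i. real (w i)"] by simp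
qed

lemma svd_top:
  fixes A :: "complex^'n^'n" and K :: "'n set"
  obtains U V s where "unitary_matrix U" "unitary_matrix V"
    "U ** A ** V = diagm (\<lambda>i. of_real (s i))" "\<And>i. s i \<ge> 0" "\<And>i j. i \<in> K \<Longrightarrow> j \<notin> K \<Longrightarrow> s i \<ge> (s j :: real)"
proof -
  obtain w :: "'n \<Rightarrow> real" where w: "inj w" "\<And>i. w i > 0" "\<And>i j. i \<in> K \<Longrightarrow> j \<notin> K \<Longrightarrow> w i > w j"
    by (rule ex_weight [of K]) blast
  show ?thesis by (rule svd_sorted [OF w(1,2), of A]) (use w(3) that in blast)
qed

abbreviation ptrace :: "'n set \<Rightarrow> complex^'n^'n \<Rightarrow> real"
  where "ptrace K \<equiv> wtrace (indicator K)"

lemma ptrace_sum: "ptrace K M = (\<Sum>i\<in>K. Re (M $ i $ i))"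
  by (simp add: wtrace_def indicator_def if_distrib if_distribR cong: if_cong)

lemma unitary_sum_norm:
  assumes "unitary_matrix U"
  shows "(\<Sum>i\<in>UNIV. (cmod (U $ i $ j))\<^sup>2) = 1" "(\<Sum>j\<in>UNIV. (cmod (U $ i $ j))\<^sup>2) = 1"
proof -
  have "(adj U ** U) $ j $ j = of_real (\<Sum>i\<in>UNIV. (cmod (U $ i $ j))\<^sup>2)"
    by (simp add: matrix_matrix_mult_def complex_norm_square mult.commute del: of_real_power)
  moreover have "(adj U ** U) $ j $ j = 1" using assms by (simp add: unitary_cancel mat_def)
  ultimately show "(\<Sum>i\<in>UNIV. (cmod (U $ i $ j))\<^sup>2) = 1" by (metis of_real_eq_1_iff)
  have "(U ** adj U) $ i $ i = of_real (\<Sum>j\<in>UNIV. (cmod (U $ i $ j))\<^sup>2)"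
    by (simp add: matrix_matrix_mult_def complex_norm_square mult.commute del: of_real_power)
  moreover have "(U ** adj U) $ i $ i = 1" using assms by (simp add: unitary_cancel mat_def)
  ultimately show "(\<Sum>j\<in>UNIV. (cmod (U $ i $ j))\<^sup>2) = 1" by (metis of_real_eq_1_iff)
qed

text \<open>By the inequality of arithmetic and geometric means, the partial trace is at most the
  sum of the s_j t_j, where the t_j lie in [0, 1] and add up to the size of \<open>K\<close>. Such a
  sum is largest when all the mass sits on the top values.\<close>

lemma ptrace_diagm_le:
  fixes s :: "'n::finite \<Rightarrow> real"
  assumes UV: "unitary_matrix U" "unitary_matrix V"
    and s: "\<And>i. s i \<ge> 0" "\<And>i j. i \<in> K \<Longrightarrow> j \<notin> K \<Longrightarrow> s i \<ge> s j"
  shows "ptrace K (U ** diagm (\<lambda>i. of_real (s i)) ** V) \<le> (\<Sum>i\<in>K. s i)"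
proof (cases "K = {}")
  case True
  then show ?thesis by (simp add: ptrace_sum)
next
  case False
  define t where "t j = (\<Sum>i\<in>K. ((cmod (U $ i $ j))\<^sup>2 + (cmod (V $ j $ i))\<^sup>2) / 2)" for j
  have t_le: "t j \<le> 1" for j
  proof -
    have "t j = ((\<Sum>i\<in>K. (cmod (U $ i $ j))\<^sup>2) + (\<Sum>i\<in>K. (cmod (V $ j $ i))\<^sup>2)) / 2"
      by (simp add: t_def sum.distrib sum_divide_distrib [symmetric])
    also have "\<dots> \<le> ((\<Sum>i\<in>UNIV. (cmod (U $ i $ j))\<^sup>2) + (\<Sum>i\<in>UNIV. (cmod (V $ j $ i))\<^sup>2)) / 2"
      by (intro divide_right_mono add_mono sum_mono2) auto
    finally show ?thesis using UV by (simp add: unitary_sum_norm)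
  qed
  have t_ge: "t j \<ge> 0" for j by (simp add: t_def sum_nonneg)
  have t_sum: "(\<Sum>j\<in>UNIV. t j) = card K"
  proof -
    have "(\<Sum>j\<in>UNIV. t j) = (\<Sum>i\<in>K. \<Sum>j\<in>UNIV. ((cmod (U $ i $ j))\<^sup>2 + (cmod (V $ j $ i))\<^sup>2) / 2)"
      unfolding t_def by (rule sum.swap)
    also have "\<dots> = (\<Sum>i\<in>K. 1)"
      by (simp only: sum_divide_distrib [symmetric] sum.distrib unitary_sum_norm [OF UV(1)] unitary_sum_norm [OF UV(2)])
        simp
    finally show ?thesis by simp
  qed
  have "ptrace K (U ** diagm (\<lambda>i. of_real (s i)) ** V) = (\<Sum>i\<in>K. \<Sum>j\<in>UNIV. s j * Re (U $ i $ j * V $ j $ i))"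
    by (simp add: ptrace_sum matrix_matrix_mult_def [of "U ** diagm (\<lambda>i. of_real (s i))" V] algebra_simps)
  also have "\<dots> \<le> (\<Sum>i\<in>K. \<Sum>j\<in>UNIV. s j * (((cmod (U $ i $ j))\<^sup>2 + (cmod (V $ j $ i))\<^sup>2) / 2))"
  proof (intro sum_mono mult_left_mono s)
    fix i j
    have "Re (U $ i $ j * V $ j $ i) \<le> cmod (U $ i $ j) * cmod (V $ j $ i)"
      by (metis complex_Re_le_cmod norm_mult)
    also have "\<dots> \<le> ((cmod (U $ i $ j))\<^sup>2 + (cmod (V $ j $ i))\<^sup>2) / 2"
      using sum_squares_bound [of "cmod (U $ i $ j)" "cmod (V $ j $ i)"] by simp
    finally show "Re (U $ i $ j * V $ j $ i) \<le> ((cmod (U $ i $ j))\<^sup>2 + (cmod (V $ j $ i))\<^sup>2) / 2" .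
  qed
  also have "\<dots> = (\<Sum>j\<in>UNIV. s j * t j)"
    unfolding t_def sum_distrib_left by (rule sum.swap)
  also have "\<dots> \<le> (\<Sum>j\<in>K. s j)"
  proof -
    \<comment> \<open>The smallest value on \<open>K\<close> separates the two groups: s_j - c is
      nonnegative on \<open>K\<close> and nonpositive off it, so each term can be bounded separately
      by t_j \<le> 1 or t_j \<ge> 0.\<close>
    define c where "c = Min (s ` K)"
    have c: "s i \<ge> c" if "i \<in> K" for i using that by (simp add: c_def)
    have "c \<in> s ` K" using False unfolding c_def by (intro Min_in) auto
    then obtain i0 where "i0 \<in> K" "s i0 = c" by auto
    then have c': "s j \<le> c" if "j \<notin> K" for j using s(2) that by blast
    have "(\<Sum>j\<in>UNIV. (s j - c) * t j) \<le> (\<Sum>j\<in>UNIV. if j \<in> K then s j - c else 0)"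
    proof (rule sum_mono)
      fix j
      show "(s j - c) * t j \<le> (if j \<in> K then s j - c else 0)"
        using c [of j] c' [of j] t_le [of j] t_ge [of j]
        by (auto simp: mult_left_le mult_nonpos_nonneg)
    qed
    also have "\<dots> = (\<Sum>j\<in>K. s j - c)"
      by (simp add: sum.If_cases)
    also have "\<dots> = (\<Sum>j\<in>K. s j) - c * card K"
      by (simp add: sum_subtractf)
    finally show ?thesis
      by (simp add: left_diff_distrib sum_subtractf sum_distrib_left [symmetric] t_sum)
  qed
  finally show ?thesis .
qed

lemma ptrace_le_ky_fan_norm:
  assumes UV: "unitary_matrix U" "unitary_matrix V" and K: "card K = k"
  shows "ptrace K (U ** A ** V) \<le> ky_fan_norm k A"
proof -
  obtain X Y s where XY: "unitary_matrix X" "unitary_matrix Y"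
    and s: "X ** A ** Y = diagm (\<lambda>i. of_real (s i))" "\<And>i. s i \<ge> 0" "\<And>i j. i \<in> K \<Longrightarrow> j \<notin> K \<Longrightarrow> s i \<ge> (s j :: real)"
    by (rule svd_top [of A K]) blast
  have "U ** A ** V = (U ** adj X) ** diagm (\<lambda>i. of_real (s i)) ** (adj Y ** V)"
    unfolding s(1) [symmetric] using XY by (simp add: matrix_mul_assoc unitary_cancel)
  also have "ptrace K \<dots> \<le> (\<Sum>i\<in>K. s i)"
    using UV XY s by (intro ptrace_diagm_le unitary_mult) auto
  also have "\<dots> = ky_fan_norm k A"
    using ky_fan_norm_svd [OF XY s(1,2) K s(3)] by simp
  finally show ?thesis .
qed

lemma ky_fan_norm_attained:
  assumes K: "card K = k"
  obtains U V where "unitary_matrix U" "unitary_matrix V" "ptrace K (U ** A ** V) = ky_fan_norm k A"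
proof -
  obtain X Y s where XY: "unitary_matrix X" "unitary_matrix Y"
    and s: "X ** A ** Y = diagm (\<lambda>i. of_real (s i))" "\<And>i. s i \<ge> 0" "\<And>i j. i \<in> K \<Longrightarrow> j \<notin> K \<Longrightarrow> s i \<ge> (s j :: real)"
    by (rule svd_top [of A K]) blast
  have "ptrace K (X ** A ** Y) = ky_fan_norm k A"
    using ky_fan_norm_svd [OF XY s(1,2) K s(3)] by (simp add: s(1) ptrace_sum)
  with XY that show ?thesis by blast
qed

lemma ky_fan_norm_eq_0:
  fixes A :: "complex^'n^'n"
  assumes K: "card (K :: 'n set) = k" and "K \<noteq> {}" and 0: "ky_fan_norm k A = 0"
  shows "A = 0"
proof -
  obtain X Y s where XY: "unitary_matrix X" "unitary_matrix Y"
    and s: "X ** A ** Y = diagm (\<lambda>i. of_real (s i))" "\<And>i. s i \<ge> 0" "\<And>i j. i \<in> K \<Longrightarrow> j \<notin> K \<Longrightarrow> s i \<ge> (s j :: real)"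
    by (rule svd_top [of A K]) blast
  have "(\<Sum>i\<in>K. s i) = 0" using ky_fan_norm_svd [OF XY s(1,2) K s(3)] 0 by simp
  then have "s i = 0" if "i \<in> K" for i using that s(2) by (simp add: sum_nonneg_eq_0_iff)
  moreover have "s j \<le> 0" if "j \<notin> K" for j using that \<open>K \<noteq> {}\<close> calculation s(3) by fastforce
  ultimately have "s i = 0" for i using s(2) by (metis order_antisym)
  then have "X ** A ** Y = 0" by (simp add: s(1) vec_eq_iff)
  then show ?thesis using unitary_eq_0_iff [OF XY] by simp
qed

lemma ky_fan_norm_unitary:
  fixes A :: "complex^'n^'n"
  assumes UV: "unitary_matrix U" "unitary_matrix V" and k: "k \<le> CARD('n)"
  shows "ky_fan_norm k (U ** A ** V) = ky_fan_norm k A"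
proof -
  obtain K :: "'n set" where K: "card K = k" using k ex_card by blast
  have le: "ky_fan_norm k (U ** A ** V) \<le> ky_fan_norm k A"
    if UV: "unitary_matrix U" "unitary_matrix V" for A U V :: "complex^'n^'n"
  proof -
    obtain X Y where XY: "unitary_matrix X" "unitary_matrix Y" "ptrace K (X ** (U ** A ** V) ** Y) = ky_fan_norm k (U ** A ** V)"
      by (rule ky_fan_norm_attained [OF K])
    have "ptrace K ((X ** U) ** A ** (V ** Y)) \<le> ky_fan_norm k A"
      using UV XY by (intro ptrace_le_ky_fan_norm unitary_mult K)
    then show ?thesis using XY(3) by (simp add: matrix_mul_assoc)
  qed
  have "A = adj U ** (U ** A ** V) ** adj V"
    using UV by (simp add: matrix_mul_assoc unitary_cancel)
  then show ?thesis
    using le [OF UV, of A] le [of "adj U" "adj V" "U ** A ** V"] UV by (intro order_antisym) simp_all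
qed

text \<open>Transposing a singular value decomposition exchanges and transposes the unitary factors
  and keeps the singular values.\<close>

lemma ky_fan_norm_transpose:
  fixes A :: "complex^'n^'n"
  assumes k: "k \<le> CARD('n)"
  shows "ky_fan_norm k (transpose A) = ky_fan_norm k A"
proof -
  obtain K :: "'n set" where K: "card K = k" using k ex_card by blast
  obtain X Y s where XY: "unitary_matrix X" "unitary_matrix Y"
    and s: "X ** A ** Y = diagm (\<lambda>i. of_real (s i))" "\<And>i. s i \<ge> 0" "\<And>i j. i \<in> K \<Longrightarrow> j \<notin> K \<Longrightarrow> s i \<ge> (s j :: real)"
    by (rule svd_top [of A K]) blast
  have "transpose Y ** transpose A ** transpose X = transpose (X ** A ** Y)"
    by (simp add: matrix_transpose_mul matrix_mul_assoc)
  also have "\<dots> = diagm (\<lambda>i. of_real (s i))"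
    by (auto simp: s(1) vec_eq_iff transpose_def)
  finally show ?thesis
    using ky_fan_norm_svd [OF XY s(1,2) K s(3)]
      ky_fan_norm_svd [OF unitary_transpose [OF XY(2)] unitary_transpose [OF XY(1)] _ s(2) K s(3), of "transpose A"]
    by simp
qed

lemma ky_fan_norm_diagm:
  assumes XY: "unitary_matrix X" "unitary_matrix Y" and K: "card K = k" and d: "\<And>i. i \<notin> K \<Longrightarrow> d i = 0"
  shows "ky_fan_norm k (X ** diagm d ** Y) = (\<Sum>i\<in>K. cmod (d i))"
proof (rule ky_fan_norm_svd)
  \<comment> \<open>These phases, absorbed into the left unitary factor, rotate the diagonal entries
    to their moduli; the value 1 at zero entries keeps the factor unitary.\<close>
  define e where "e i = (if d i = 0 then 1 else cnj (d i) / cmod (d i))" for i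
  have e: "e i * d i = cmod (d i)" for i
    by (simp add: e_def complex_norm_square [symmetric] power2_eq_square mult.commute)
  show "unitary_matrix (diagm e ** adj X)"
    using XY(1) by (intro unitary_mult unitary_diagm) (auto simp: e_def norm_divide)
  show "unitary_matrix (adj Y)" using XY(2) by simp
  show "(diagm e ** adj X) ** (X ** diagm d ** Y) ** adj Y = diagm (\<lambda>i. of_real (cmod (d i)))"
    using XY by (simp add: matrix_mul_assoc unitary_cancel) (simp add: vec_eq_iff e matrix_mul_assoc [symmetric] unitary_cancel)
qed (use K d in auto)

lemma ky_fan_norm_cscale:
  fixes A :: "complex^'n^'n"
  assumes k: "k \<le> CARD('n)"
  shows "ky_fan_norm k (c *\<^sub>C A) = cmod c * ky_fan_norm k A"
proof -
  obtain K :: "'n set" where K: "card K = k" using k ex_card by blast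
  obtain X Y s where XY: "unitary_matrix X" "unitary_matrix Y"
    and s: "X ** A ** Y = diagm (\<lambda>i. of_real (s i))" "\<And>i. s i \<ge> 0" "\<And>i j. i \<in> K \<Longrightarrow> j \<notin> K \<Longrightarrow> s i \<ge> (s j :: real)"
    by (rule svd_top [of A K]) blast
  define e where "e = (if c = 0 then 1 else cnj c / cmod c)"
  have e: "e * c = cmod c" "cmod e = 1"
    by (simp_all add: e_def complex_norm_square [symmetric] power2_eq_square mult.commute norm_divide)
  have "ky_fan_norm k (c *\<^sub>C A) = (\<Sum>i\<in>K. cmod c * s i)"
  proof (rule ky_fan_norm_svd)
    show "unitary_matrix (diagm (\<lambda>_. e) ** X)" using XY e by (intro unitary_mult unitary_diagm) auto
    have "diagm (\<lambda>_. e) ** X = e *\<^sub>C X" by (simp add: vec_eq_iff)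
    then show "(diagm (\<lambda>_. e) ** X) ** (c *\<^sub>C A) ** Y = diagm (\<lambda>i. of_real (cmod c * s i))"
      by (simp add: s(1) e) (simp add: vec_eq_iff e mult.assoc [symmetric] mult.commute [of c e])
  qed (use XY s K in \<open>auto intro: mult_left_mono\<close>)
  then show ?thesis using ky_fan_norm_svd [OF XY s(1,2) K s(3)] by (simp add: sum_distrib_left)
qed

text \<open>A maximising pair for A + B gives two partial traces, each bounded by its norm, whose
  sum is the sum of the norms; hence both bounds are attained.\<close>

lemma ky_fan_norm_triangle_eq:
  fixes A B :: "complex^'n^'n"
  assumes K: "card (K :: 'n set) = k" and eq: "ky_fan_norm k (A + B) = ky_fan_norm k A + ky_fan_norm k B"
  obtains U V where "unitary_matrix U" "unitary_matrix V"
    "ptrace K (U ** A ** V) = ky_fan_norm k A" "ptrace K (U ** B ** V) = ky_fan_norm k B"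
proof -
  obtain U V where UV: "unitary_matrix U" "unitary_matrix V" "ptrace K (U ** (A + B) ** V) = ky_fan_norm k (A + B)"
    by (rule ky_fan_norm_attained [OF K])
  have "ptrace K (U ** A ** V) + ptrace K (U ** B ** V) = ky_fan_norm k A + ky_fan_norm k B"
    using UV(3) eq by (simp add: matrix_add_ldistrib matrix_add_rdistrib wtrace_linear)
  with ptrace_le_ky_fan_norm [OF UV(1,2) K, of A] ptrace_le_ky_fan_norm [OF UV(1,2) K, of B] UV that
  show ?thesis by force
qed

lemma wmaximal_normed:
  fixes A :: "complex^'n^'n"
  assumes UV: "unitary_matrix U" "unitary_matrix V" and K: "card K = k"
    and eq: "ptrace K (U ** A ** V) = ky_fan_norm k A"
  shows "wmaximal (indicator K) (U ** A ** V)"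
  unfolding wmaximal_def eq
proof (intro allI impI)
  fix X Y :: "complex^'n^'n"
  assume "unitary_matrix X" "unitary_matrix Y"
  with UV have "ptrace K ((X ** U) ** A ** (V ** Y)) \<le> ky_fan_norm k A"
    by (intro ptrace_le_ky_fan_norm unitary_mult K)
  then show "ptrace K (X ** (U ** A ** V) ** Y) \<le> ky_fan_norm k A"
    by (simp add: matrix_mul_assoc)
qed

section \<open>Products of positive semidefinite matrices\<close>

text \<open>Here the weighted trace is maximised over unitary conjugates of \<open>G\<close>.
  Stationarity makes \<open>W ** H\<close> Hermitian, so \<open>H\<close> commutes with the diagonal
  matrix \<open>W\<close>, whose entries are distinct, and is therefore diagonal.\<close>

lemma hermitian_diagonalise:
  fixes G :: "complex^'n^'n"
  assumes G: "adj G = G"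
  obtains Q d where "unitary_matrix Q" "adj Q ** G ** Q = diagm d"
proof -
  obtain w :: "'n \<Rightarrow> real" where w: "inj w"
    using ex_weight [of "{} :: 'n set"] by metis
  let ?S = "{U :: complex^'n^'n. unitary_matrix U}"
  have "\<exists>Q\<in>?S. \<forall>R\<in>?S. wtrace w (adj R ** G ** R) \<le> wtrace w (adj Q ** G ** Q)"
    by (intro continuous_attains_sup compact_unitary continuous_intros)
       (auto intro: unitary_mat_1)
  then obtain Q where Q: "unitary_matrix Q"
    and max: "\<And>R. unitary_matrix R \<Longrightarrow> wtrace w (adj R ** G ** R) \<le> wtrace w (adj Q ** G ** Q)"
    by auto
  define W where "W = diagm (\<lambda>i. complex_of_real (w i))"
  define H where "H = adj Q ** G ** Q"
  have H: "adj H = H" by (simp add: H_def adj_mult G matrix_mul_assoc)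
  have W: "adj W = W" by (simp add: W_def)
  have "Im (cdot v ((W ** H) *v v)) = 0" for v
  proof (cases "v = 0")
    case False
    define n where "n = Re (cdot v v)"
    have n: "n > 0" "cdot v v = of_real n"
      using cdot_self_real [of v] False by (simp_all add: n_def complex_eq_iff)
    define a where "a = cdot v ((W ** H) *v v)"
    define b where "b = cdot v (H *v v) * cdot v (W *v v)"
    have a': "cdot v ((H ** W) *v v) = cnj a"
      by (simp add: a_def cnj_cdot cdot_adj [of v] adj_mult H W)
    have "Im (cdot v (H *v v)) = 0" "Im (cdot v (W *v v)) = 0"
      using cnj_cdot [of v "H *v v"] cnj_cdot [of v "W *v v"] cdot_adj [of v H v] cdot_adj [of v W v]
      by (simp_all add: H W complex_eq_iff)
    then have b: "b = of_real (Re b)" by (simp add: b_def complex_eq_iff)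
    \<comment> \<open>Conjugation uses the reflection on both sides, which doubles the linear term
      and adds the quadratic term with \<open>b\<close>; \<open>circle_ineq\<close> tolerates that
      term.\<close>
    have "Re ((t - 1) * (2 * a / n)) + (cmod (t - 1))\<^sup>2 * (Re b / n\<^sup>2) \<le> 0" if t: "cmod t = 1" for t
    proof -
      define c where "c = (t - 1) / of_real n"
      let ?R = "phase_refl v t"
      have R: "?R = mat 1 + c *\<^sub>C outer v v" "adj ?R = mat 1 + cnj c *\<^sub>C outer v v"
        by (simp_all add: phase_refl_def c_def n(2))
      have "trace (W ** (adj ?R ** H ** ?R)) = trace (W ** H) + c * a + cnj c * cnj a + cnj c * c * b"
      proof -
        have "W ** (adj ?R ** H ** ?R) = W ** H + c *\<^sub>C ((W ** H) ** outer v v)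
            + cnj c *\<^sub>C (W ** outer v v ** H) + (cnj c * c) *\<^sub>C (W ** outer v v ** H ** outer v v)"
          unfolding R by (simp add: matrix_add_ldistrib matrix_add_rdistrib matrix_mul_assoc cscale_distrib mult_ac add_ac)
        moreover have "trace (W ** outer v v ** H) = cnj a"
          by (metis a' matrix_mul_assoc trace_mul_sym trace_mult_outer)
        moreover have "trace (W ** outer v v ** H ** outer v v) = b"
          by (simp add: b_def trace_outer mult_outer matrix_vector_mul_assoc [symmetric] outer_mult_vec vec_smult_mult)
        ultimately show ?thesis
          by (simp add: trace_add a_def trace_mult_outer)
      qed
      moreover have "Re (trace (W ** (adj ?R ** H ** ?R))) \<le> Re (trace (W ** H))"
        using max [OF unitary_mult [OF Q unitary_phase_refl [OF t, of v]]]
        by (simp add: wtrace_trace W_def H_def adj_mult matrix_mul_assoc)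
      ultimately have "Re (c * a) + Re (cnj c * cnj a) + Re (cnj c * c * b) \<le> 0" by simp
      moreover have "Re (cnj c * c * b) = (cmod c)\<^sup>2 * Re b"
        by (subst b) (simp add: complex_norm_square [symmetric] mult.commute [of "cnj c"] del: of_real_power)
      ultimately have "Re (c * (2 * a)) + (cmod c)\<^sup>2 * Re b \<le> 0" by (simp add: algebra_simps)
      moreover have "Re (c * (2 * a)) = Re ((t - 1) * (2 * a / n))" by (simp add: c_def)
      moreover have "(cmod c)\<^sup>2 = (cmod (t - 1))\<^sup>2 / n\<^sup>2"
        by (simp add: c_def norm_divide power_divide)
      ultimately show ?thesis by simp
    qed
    then have "Im (2 * a / n) = 0" by (rule circle_ineq)
    then show ?thesis using n(1) by (simp add: a_def)
  qed simp
  then have "adj (W ** H) = W ** H" by (rule hermitian_if_real_form)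
  then have "H ** W = W ** H" by (simp add: adj_mult H W)
  then have "H $ i $ j * w j = w i * H $ i $ j" for i j
    by (simp add: W_def vec_eq_iff)
  then have "H $ i $ j = 0 \<or> w i = w j" for i j
    by (metis mult.commute mult_cancel_right of_real_eq_iff)
  then have "H $ i $ j = 0" if "i \<noteq> j" for i j
    using that w by (metis injD)
  then have "H = diagm (\<lambda>i. H $ i $ i)" by (simp add: vec_eq_iff)
  with Q show ?thesis using that unfolding H_def by metis
qed

lemma psd_conj: "psd G \<Longrightarrow> psd (adj C ** G ** C)"
  unfolding psd_def by (metis adj_simps(1) cdot_adj matrix_vector_mul_assoc)

lemma psd_sqrt:
  fixes G :: "complex^'n^'n"
  assumes "psd G"
  obtains C where "adj C = C" "C ** C = G"
proof -
  obtain Q d where Q: "unitary_matrix Q" "adj Q ** G ** Q = diagm d"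
    using hermitian_diagonalise [OF psd_adj [OF assms]] by blast
  have "psd (diagm d)" using psd_conj [OF assms, of Q] by (simp add: Q)
  from psd_diag_entry [OF this] have d: "d i = of_real (Re (d i))" "Re (d i) \<ge> 0" for i
    by (auto simp: complex_eq_iff)
  define R where "R = diagm (\<lambda>i. complex_of_real (sqrt (Re (d i))))"
  have RR: "R ** R = diagm d"
    using d by (simp add: R_def diagm_mult_diagm of_real_mult [symmetric] del: of_real_mult)
  define C where "C = Q ** R ** adj Q"
  have "adj C = C" by (simp add: C_def adj_mult matrix_mul_assoc) (simp add: R_def)
  moreover have "C ** C = Q ** (R ** R) ** adj Q"
    by (simp add: C_def matrix_mul_assoc unitary_cancel [OF Q(1)])
  moreover have "Q ** (R ** R) ** adj Q = G"
    unfolding RR Q(2) [symmetric] by (simp add: matrix_mul_assoc unitary_cancel [OF Q(1)])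
  ultimately show ?thesis using that by simp
qed

text \<open>With C^2 = H, an eigenvector u of C G C for a positive eigenvalue gives the eigenvector
  C u of H G. So the positive semidefinite matrix C G C vanishes. With E^2 = G it equals (E C)^* (E
  C), hence E C = 0, and then C E = 0 and H G = C (C E) E = 0.\<close>

lemma psd_mult_eq_0:
  fixes G H :: "complex^'n^'n"
  assumes G: "psd G" and H: "psd H"
    and ev: "\<And>l v. l > 0 \<Longrightarrow> v \<noteq> 0 \<Longrightarrow> (H ** G) *v v \<noteq> of_real l *s v"
  shows "H ** G = 0"
proof -
  obtain C where C: "adj C = C" "C ** C = H" using psd_sqrt [OF H] by blast
  obtain E where E: "adj E = E" "E ** E = G" using psd_sqrt [OF G] by blast
  define F where "F = C ** G ** C"
  have F: "psd F" using psd_conj [OF G, of C] by (simp add: F_def C)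
  obtain Q d where Q: "unitary_matrix Q" "adj Q ** F ** Q = diagm d"
    using hermitian_diagonalise [OF psd_adj [OF F]] by blast
  have "psd (diagm d)" using psd_conj [OF F, of Q] by (simp add: Q)
  from psd_diag_entry [OF this] have d: "d i = of_real (Re (d i))" "Re (d i) \<ge> 0" for i
    by (auto simp: complex_eq_iff)
  have "d i = 0" for i
  proof (rule ccontr)
    assume "d i \<noteq> 0"
    with d [of i] have pos: "Re (d i) > 0" by (metis less_eq_real_def of_real_0)
    define u where "u = Q *v axis i 1"
    have "F *v u = Q *v (diagm d *v axis i 1)"
      using Q(1) by (simp add: u_def Q(2) [symmetric] matrix_vector_mul_assoc matrix_mul_assoc unitary_cancel)
    also have "diagm d *v axis i 1 = d i *s axis i 1"
      by (simp add: vec_eq_iff axis_def)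
    finally have Fu: "F *v u = d i *s u" by (simp add: vec_smult_mult u_def)
    have "u \<noteq> 0"
      using Q(1) by (metis axis_eq_0_iff matrix_vector_mult_0_right u_def unitary_cancel(7) zero_neq_one)
    moreover have "C *v u = 0 \<Longrightarrow> F *v u = 0" by (simp add: F_def matrix_vector_mul_assoc [symmetric])
    ultimately have "C *v u \<noteq> 0" using Fu \<open>d i \<noteq> 0\<close> by (metis vector_mul_eq_0)
    moreover have "(H ** G) *v (C *v u) = C *v (F *v u)"
      by (simp add: F_def C(2) [symmetric] matrix_vector_mul_assoc matrix_mul_assoc)
    then have "(H ** G) *v (C *v u) = of_real (Re (d i)) *s (C *v u)"
      using d(1) by (simp add: Fu vec_smult_mult)
    ultimately show False using ev pos by blast
  qed
  then have "adj Q ** F ** Q = 0" by (simp add: Q(2) vec_eq_iff)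
  then have "F = 0" using Q(1) by (simp add: unitary_eq_0_iff)
  then have "adj (E ** C) ** (E ** C) = 0"
    by (simp add: F_def adj_mult C(1) E matrix_mul_assoc [symmetric]) (simp add: E(2) matrix_mul_assoc)
  then have "E ** C = 0" by (rule adj_mult_self_eq_0)
  then have "adj (E ** C) = 0" by simp
  then have "C ** E = 0" by (simp add: adj_mult C(1) E(1))
  have "H ** G = C ** (C ** E) ** E"
    by (simp add: C(2) [symmetric] E(2) [symmetric] matrix_mul_assoc)
  then show ?thesis by (simp add: \<open>C ** E = 0\<close>)
qed

lemma mat_mult_vec: "mat l *v v = l *s (v :: complex^'n)"
  by (simp add: vec_eq_iff matrix_vector_mult_def mat_def if_distrib if_distribR cong: if_cong)

text \<open>Eigenvalues are roots of the characteristic polynomial, which is nonzero because a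
  number exceeding all absolute row sums cannot be an eigenvalue.\<close>

lemma finite_eigenvalues:
  fixes A :: "complex^'n^'n"
  shows "finite {l. \<exists>v. v \<noteq> 0 \<and> A *v v = l *s v}"
proof -
  have ker: "det (mat l - A) = 0" if "v \<noteq> 0" "A *v v = l *s v" for l v
  proof -
    have "(mat l - A) *v v = 0"
      using that(2) by (simp add: matrix_vector_mult_diff_rdistrib mat_mult_vec)
    with that(1) have "\<not> invertible (mat l - A)"
      by (metis invertible_def matrix_left_invertible_ker)
    then show ?thesis by (simp add: invertible_det_nz)
  qed
  have "charpoly A \<noteq> 0"
  proof
    assume 0: "charpoly A = 0"
    \<comment> \<open>The sum over all entries dominates each row sum, and the added 1 makes the
      bound strict. The contradiction is read off at a coordinate where the eigenvector has maximal
      modulus.\<close>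
    define B where "B = (\<Sum>i\<in>UNIV. \<Sum>j\<in>UNIV. cmod (A $ i $ j)) + 1"
    have B: "B \<ge> 0" by (simp add: B_def sum_nonneg)
    have "det (mat (of_real B) - A) = 0" using poly_charpoly [of A "of_real B"] by (simp add: 0)
    then have "\<not> invertible (mat (of_real B) - A)" by (simp add: invertible_det_nz)
    then obtain v where v: "v \<noteq> 0" "(mat (of_real B) - A) *v v = 0"
      by (metis invertible_def matrix_left_invertible_ker matrix_left_right_inverse)
    then have "A *v v = of_real B *s v"
      by (simp add: matrix_vector_mult_diff_rdistrib mat_mult_vec)
    then have Av: "(A *v v) $ i = of_real B * v $ i" for i by simp
    define m where "m = Max (range (\<lambda>i. cmod (v $ i)))"
    have m: "cmod (v $ i) \<le> m" for i by (simp add: m_def)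
    have "m \<in> range (\<lambda>i. cmod (v $ i))" unfolding m_def by (intro Max_in) auto
    then obtain i where i: "m = cmod (v $ i)" by auto
    have "m > 0" using v(1) m by (metis order.strict_trans2 vec_eq_iff zero_index zero_less_norm_iff)
    have "B * m = cmod (of_real B * v $ i)"
      using B by (simp add: norm_mult i)
    also have "\<dots> \<le> (\<Sum>j\<in>UNIV. cmod (A $ i $ j * v $ j))"
      unfolding Av [symmetric] matrix_vector_mult_def by (simp add: norm_sum)
    also have "\<dots> \<le> (\<Sum>j\<in>UNIV. cmod (A $ i $ j) * m)"
      by (intro sum_mono) (simp add: norm_mult m mult_left_mono)
    also have "\<dots> = (\<Sum>j\<in>UNIV. cmod (A $ i $ j)) * m" by (simp add: sum_distrib_right)
    finally have "B \<le> (\<Sum>j\<in>UNIV. cmod (A $ i $ j))" using \<open>m > 0\<close> by simp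
    also have "\<dots> \<le> (\<Sum>i\<in>UNIV. \<Sum>j\<in>UNIV. cmod (A $ i $ j))"
      by (rule member_le_sum) (auto intro: sum_nonneg)
    finally show False by (simp add: B_def)
  qed
  then have "finite {l. poly (charpoly A) l = 0}" by (rule poly_roots_finite)
  moreover have "{l. \<exists>v. v \<noteq> 0 \<and> A *v v = l *s v} \<subseteq> {l. poly (charpoly A) l = 0}"
    using ker by (auto simp: poly_charpoly)
  ultimately show ?thesis by (rule rev_finite_subset)
qed

section \<open>Additive pairs for all phases\<close>

lemma of_real_indicator: "(\<lambda>i. complex_of_real (indicator K i)) = indicator K"
  by (auto simp: indicator_def)

lemma cnj_indicator [simp]: "cnj (indicator K i) = indicator K i"
  by (simp add: indicator_def)

lemma proj_idem: "proj K ** proj K = proj K"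
  by (simp add: vec_eq_iff indicator_def)

lemma adj_proj: "adj (proj K) = proj K"
  by simp

text \<open>Positive semidefiniteness makes both M P and P M Hermitian. Together with P^2 = P this
  identifies each of them with P M P.\<close>

lemma wmaximal_proj:
  assumes "wmaximal (indicator K) M"
  shows "psd (M ** proj K)" "proj K ** M = M ** proj K"
proof -
  note psd = wmaximal_psd [OF assms, unfolded of_real_indicator]
  show "psd (M ** proj K)" by (rule psd)
  have 1: "proj K ** adj M = M ** proj K" using psd_adj [OF psd(1)] by (simp add: adj_mult adj_proj)
  have 2: "adj M ** proj K = proj K ** M" using psd_adj [OF psd(2)] by (simp add: adj_mult adj_proj)
  have "M ** proj K = proj K ** (M ** proj K)"
    by (metis 1 matrix_mul_assoc proj_idem)
  moreover have "proj K ** M = proj K ** M ** proj K"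
    by (metis 2 matrix_mul_assoc proj_idem)
  ultimately show "proj K ** M = M ** proj K" by (simp add: matrix_mul_assoc)
qed

text \<open>Reflections moving \<open>q\<close> and \<open>p\<close> to \<open>z\<close> replace the direction \<open>z\<close> in the partial trace by the
  pair \<open>(q, p)\<close>.\<close>

lemma wmaximal_exchange:
  assumes max: "wmaximal (indicator K) M"
    and unit: "cdot z z = 1" "cdot p p = 1" "cdot q q = 1"
    and P: "proj K *v z = z" "proj K *v p = 0" "proj K *v q = 0"
  shows "Re (cdot q (M *v p)) \<le> Re (cdot z (M *v z))"
proof -
  have orth: "cdot z r = 0" "cdot r z = 0" if "proj K *v r = 0" for r
  proof -
    have "cdot (proj K *v z) r = cdot z (proj K *v r)" by (simp add: cdot_adj adj_proj)
    then show "cdot z r = 0" using that P by simp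
    then show "cdot r z = 0" using cnj_cdot [of z r] by simp
  qed
  let ?R = "\<lambda>r. phase_refl (z - r) (- 1)"
  \<comment> \<open>Since z and r are orthogonal unit vectors, |z - r|^2 = 2 and the reflection,
    which swaps z and r, has coefficient -1.\<close>
  have R: "?R r = mat 1 - outer (z - r) (z - r)" if "proj K *v r = 0" "cdot r r = 1" for r
  proof -
    have "cdot (z - r) (z - r) = 2" using orth [OF that(1)] that(2) unit by (simp add: cdot_distrib)
    then show ?thesis by (simp add: phase_refl_def vec_eq_iff)
  qed
  have "?R p ** proj K ** ?R q = proj K - outer z z + outer p q"
    unfolding R [OF P(2) unit(2)] R [OF P(3) unit(3)]
    by (simp add: matrix_diff_ldistrib matrix_diff_rdistrib mult_outer outer_mult adj_proj
        matrix_vector_mult_diff_distrib matrix_vector_mult_diff_rdistrib outer_mult_vec P outer_diff unit orth)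
  then have "trace (proj K ** (?R q ** M ** ?R p)) = trace ((proj K - outer z z + outer p q) ** M)"
    by (metis matrix_mul_assoc trace_mul_sym)
  also have "\<dots> = trace (proj K ** M) - cdot z (M *v z) + cdot q (M *v p)"
    by (simp add: matrix_add_rdistrib matrix_diff_rdistrib trace_add trace_sub
      trace_mul_sym [of "outer _ _"] trace_mult_outer)
  finally have "trace (proj K ** (?R q ** M ** ?R p)) = trace (proj K ** M) - cdot z (M *v z) + cdot q (M *v p)" .
  moreover have "Re (trace (proj K ** (?R q ** M ** ?R p))) \<le> Re (trace (proj K ** M))"
    using max unitary_phase_refl [of "- 1" "z - q"] unitary_phase_refl [of "- 1" "z - p"]
    by (simp add: wmaximal_def wtrace_trace of_real_indicator)
  ultimately show ?thesis by simp
qed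

text \<open>A direction z in the range of P with M z = 0 contributes nothing to the partial trace.
  Exchanging it for coordinate vectors outside \<open>K\<close> must not gain anything, which kills
  the block of \<open>M\<close> outside \<open>K\<close>; the mixed blocks vanish because
  \<open>M\<close> commutes with P.\<close>

lemma wmaximal_supported:
  fixes M :: "complex^'n^'n"
  assumes max: "wmaximal (indicator K) M"
    and z: "z \<noteq> 0" "proj K *v z = z" "M *v z = 0"
  shows "M ** proj K = M"
proof -
  have off: "M $ a $ b = 0" if "a \<notin> K" "b \<notin> K" for a b
  proof -
    define n where "n = Re (cdot z z)"
    have n: "n > 0" "cdot z z = of_real n"
      using cdot_self_real [of z] z(1) by (simp_all add: n_def complex_eq_iff)
    define y where "y = of_real (1 / sqrt n) *s z"
    have y: "cdot y y = 1" "proj K *v y = y" "M *v y = 0"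
      using n z by (simp_all add: y_def vec_smult_mult of_real_mult [symmetric] del: of_real_mult)
    have "Re (cnj t * M $ a $ b) \<le> 0" if t: "cmod t = 1" for t
    proof -
      have "Re (cdot (t *s axis a 1) (M *v axis b 1)) \<le> Re (cdot y (M *v y))"
      proof (rule wmaximal_exchange [OF max y(1) _ _ y(2)])
        show "cdot (t *s axis a 1) (t *s axis a 1) = 1"
          using t by (simp add: complex_norm_square [symmetric] mult.commute)
        show "proj K *v axis b 1 = 0" "proj K *v (t *s axis a 1) = 0"
          using \<open>a \<notin> K\<close> \<open>b \<notin> K\<close> by (simp_all add: vec_eq_iff axis_def)
      qed simp
      then show ?thesis by (simp add: y(3) mult_vec_axis)
    qed
    \<comment> \<open>These four phases bound the real and the imaginary part of the entry from both
      sides by 0.\<close>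
    from this [of 1] this [of "-1"] this [of "\<i>"] this [of "-\<i>"] show ?thesis
      by (simp add: complex_eq_iff)
  qed
  have "proj K ** M = M ** proj K" using wmaximal_proj [OF max] by blast
  then have "indicator K a * M $ a $ b = M $ a $ b * indicator K b" for a b
    by (metis diagm_mult_component mult_diagm_component)
  then have "M $ a $ b = 0" if "b \<notin> K" for a b
    using off [of a b] that by (cases "a \<in> K") (force simp: indicator_def)+
  then show ?thesis by (auto simp: vec_eq_iff indicator_def)
qed

text \<open>The single unitary \<open>V\<close> records the rank bound: both \<open>A\<close> and
  \<open>B\<close> vanish on the image under \<open>V\<close> of the coordinate vectors outside
  \<open>K\<close>, so their row spaces share one space of dimension \<open>k\<close>.\<close>

lemma additive_phases_imp_orthogonal:
  fixes A B :: "complex^'n^'n" and K :: "'n set"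
  assumes K: "card K = k" "K \<noteq> {}" and "A \<noteq> 0" "B \<noteq> 0"
    and add: "\<And>t. cmod t = 1 \<Longrightarrow> ky_fan_norm k (A + t *\<^sub>C B) = ky_fan_norm k A + ky_fan_norm k B"
  obtains V where "unitary_matrix V" "adj A ** B = 0" "A ** adj B = 0"
    "A ** V ** proj K = A ** V" "B ** V ** proj K = B ** V"
proof -
  \<comment> \<open>Below, \<open>t A\<^sup>*B\<close> acts on the range of \<open>proj K\<close> as a product of two positive semidefinite
    matrices, which can only have a nonzero eigenvalue if it has a positive one; so \<open>t\<close> is chosen
    outside the finite set of phases for which \<open>t A\<^sup>*B\<close> has a positive eigenvalue.\<close>
  define ev where "ev = {l. \<exists>v. v \<noteq> 0 \<and> (adj A ** B) *v v = l *s v}"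
  \<comment> \<open>A finite connected set has at most one point, but the circle contains 1 and
    -1.\<close>
  have "infinite (sphere (0 :: complex) 1)"
  proof
    assume "finite (sphere (0 :: complex) 1)"
    moreover have "connected (sphere (0 :: complex) 1)" by (intro connected_sphere) simp
    ultimately obtain c :: complex where "sphere 0 1 \<subseteq> {c}"
      by (metis connected_finite_iff_sing empty_subsetI order_refl)
    moreover have "1 \<in> sphere (0 :: complex) 1" "- 1 \<in> sphere (0 :: complex) 1" by simp_all
    ultimately show False by (metis one_neq_neg_one singletonD subsetD)
  qed
  \<comment> \<open>For a nonzero eigenvalue l, the phase |l| / l is the one that makes t l
    positive. For l = 0 the quotient is 0, which is not on the circle and excludes nothing.\<close>
  moreover have "finite ((\<lambda>l. of_real (cmod l) / l) ` ev)"
    using finite_eigenvalues [of "adj A ** B"] by (simp add: ev_def)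
  ultimately obtain t where "t \<in> sphere 0 1" "t \<notin> (\<lambda>l. of_real (cmod l) / l) ` ev"
    by (metis finite_subset subsetI)
  then have t: "cmod t = 1" and not_ev: "\<And>l. l \<in> ev \<Longrightarrow> t \<noteq> of_real (cmod l) / l" by auto
  have t0: "t \<noteq> 0" using t by auto
  have k: "k \<le> CARD('n)" using K(1) by (metis card_mono finite subset_UNIV)
  have norm: "ky_fan_norm k (t *\<^sub>C B) = ky_fan_norm k B"
    using t by (simp add: ky_fan_norm_cscale [OF k])
  then have "ky_fan_norm k (A + t *\<^sub>C B) = ky_fan_norm k A + ky_fan_norm k (t *\<^sub>C B)"
    using add [OF t] by simp
  then obtain U V where UV: "unitary_matrix U" "unitary_matrix V"
    and tr: "ptrace K (U ** A ** V) = ky_fan_norm k A" "ptrace K (U ** (t *\<^sub>C B) ** V) = ky_fan_norm k (t *\<^sub>C B)"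
    by (rule ky_fan_norm_triangle_eq [OF K(1)])
  define M where "M = U ** A ** V"
  define L where "L = U ** (t *\<^sub>C B) ** V"
  have max: "wmaximal (indicator K) M" "wmaximal (indicator K) L"
    unfolding M_def L_def using wmaximal_normed [OF UV K(1)] tr by blast+
  define P where "P = proj K"
  have P: "adj P = P" "P ** P = P" by (simp_all add: P_def adj_proj proj_idem)
  note M = wmaximal_proj [OF max(1), folded P_def]
  note L = wmaximal_proj [OF max(2), folded P_def]
  have nz: "X ** P \<noteq> 0" if "ptrace K X = ky_fan_norm k Y" "Y \<noteq> 0" for X Y :: "complex^'n^'n"
  proof
    assume "X ** P = 0"
    then have "X $ i $ i = 0" if "i \<in> K" for i
      using that mult_diagm_component [of X "indicator K" i i] by (simp add: P_def)
    then have "ky_fan_norm k Y = 0" using that(1) by (simp add: ptrace_sum)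
    then show False using ky_fan_norm_eq_0 [OF K] that(2) by blast
  qed
  have nz': "M ** P \<noteq> 0" "L ** P \<noteq> 0"
    using nz [OF tr(1) \<open>A \<noteq> 0\<close>] nz [OF tr(2) [unfolded norm] \<open>B \<noteq> 0\<close>] by (simp_all add: M_def L_def)
  have adjM_L: "adj M ** L = t *\<^sub>C (adj V ** (adj A ** B) ** V)"
    using UV(1) by (simp add: M_def L_def adj_mult matrix_mul_assoc unitary_cancel)
  have HG: "(M ** P) ** (L ** P) = 0"
  proof (rule psd_mult_eq_0 [OF L(1) M(1)])
    fix l :: real and v :: "complex^'n"
    assume l: "l > 0" and "v \<noteq> 0"
    show "(M ** P ** (L ** P)) *v v \<noteq> of_real l *s v"
    proof
      assume e: "(M ** P ** (L ** P)) *v v = of_real l *s v"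
      have MP: "M ** P = adj M ** P"
        using psd_adj [OF M(1)] arg_cong [OF M(2), of adj] by (simp add: adj_mult P)
      have *: "M ** P ** (L ** P) = adj M ** L ** P" "P ** (adj M ** L ** P) = adj M ** L ** P"
      proof -
        have "M ** P ** (L ** P) = adj M ** (P ** L) ** P" by (simp add: MP matrix_mul_assoc)
        also have "\<dots> = adj M ** L ** (P ** P)" by (simp add: L(2) matrix_mul_assoc)
        finally show 1: "M ** P ** (L ** P) = adj M ** L ** P" by (simp add: P)
        have "P ** (M ** P) = M ** P" using M(2) by (metis P(2) matrix_mul_assoc)
        then show "P ** (adj M ** L ** P) = adj M ** L ** P"
          unfolding 1 [symmetric] by (simp add: matrix_mul_assoc)
      qed
      \<comment> \<open>As l is nonzero, the eigenvector lies in the range of P. It is then an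
        eigenvector of M^* L, and \<open>V\<close> carries it to an eigenvector of A^* B for the
        eigenvalue l / t, which the choice of t forbids.\<close>
      have "P *v (of_real l *s v) = of_real l *s v"
        by (metis e * matrix_vector_mul_assoc)
      then have Pv: "P *v v = v" using l by (simp add: vec_smult_mult)
      have "(adj M ** L) *v v = of_real l *s v"
        by (metis Pv * e matrix_vector_mul_assoc)
      then have "t *s (adj V *v ((adj A ** B) *v (V *v v))) = of_real l *s v"
        by (simp add: adjM_L cscale_mult_vec matrix_vector_mul_assoc matrix_mul_assoc)
      then have "V *v (t *s (adj V *v ((adj A ** B) *v (V *v v)))) = V *v (of_real l *s v)" by simp
      then have "t *s ((adj A ** B) *v (V *v v)) = of_real l *s (V *v v)"
        using UV(2) by (simp add: vec_smult_mult unitary_cancel)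
      then have "inverse t *s (t *s ((adj A ** B) *v (V *v v))) = inverse t *s (of_real l *s (V *v v))" by simp
      then have "(adj A ** B) *v (V *v v) = (of_real l / t) *s (V *v v)"
        using t0 by (simp add: divide_inverse mult.commute)
      moreover have "V *v v \<noteq> 0"
        using UV(2) \<open>v \<noteq> 0\<close> by (metis matrix_vector_mult_0_right unitary_cancel(7))
      ultimately have "of_real l / t \<in> ev" by (auto simp: ev_def)
      then have "t \<noteq> of_real (cmod (of_real l / t)) / (of_real l / t)" by (rule not_ev)
      then show False using t l by (simp add: norm_divide)
    qed
  qed
  have GH: "(L ** P) ** (M ** P) = 0"
    using arg_cong [OF HG, of adj] psd_adj [OF M(1)] psd_adj [OF L(1)]
    by (simp add: adj_mult [of "M ** P" "L ** P"])
  \<comment> \<open>A nonzero column of \<open>Y ** P\<close> lies in the range of P and is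
    annihilated by \<open>X\<close>, as \<open>wmaximal_supported\<close> requires.\<close>
  have supp: "X ** P = X"
    if X: "wmaximal (indicator K) X" and Y: "Y ** P \<noteq> 0" "P ** Y = Y ** P" "X ** P ** (Y ** P) = 0" for X Y
  proof -
    obtain j where "(Y ** P) *v axis j 1 \<noteq> 0"
      using Y(1) by (metis mult_vec_axis vec_eq_iff zero_index)
    moreover have "P *v ((Y ** P) *v axis j 1) = (Y ** P) *v axis j 1"
      using Y(2) by (metis P(2) matrix_mul_assoc matrix_vector_mul_assoc)
    moreover have "X ** (Y ** P) = X ** P ** (Y ** P)"
      using Y(2) by (metis P(2) matrix_mul_assoc)
    then have "X *v ((Y ** P) *v axis j 1) = 0"
      using Y(3) by (simp add: matrix_vector_mul_assoc)
    ultimately show ?thesis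
      using wmaximal_supported [OF X] by (simp add: P_def)
  qed
  have supp_M: "M ** P = M" by (rule supp [OF max(1) nz'(2) L(2) HG])
  have supp_L: "L ** P = L" by (rule supp [OF max(2) nz'(1) M(2) GH])
  have M': "adj M = M" "adj L = L"
    using psd_adj [OF M(1)] psd_adj [OF L(1)] by (simp_all add: supp_M supp_L)
  have A: "A = adj U ** M ** adj V" and B: "B = inverse t *\<^sub>C (adj U ** L ** adj V)"
    using UV t0 by (simp_all add: M_def L_def matrix_mul_assoc unitary_cancel)
  show ?thesis
  proof
    show "unitary_matrix V" by (rule UV)
    have "adj A ** B = inverse t *\<^sub>C (V ** (adj M ** L) ** adj V)"
      using UV(1) unfolding A B by (simp add: adj_mult matrix_mul_assoc unitary_cancel)
    then show "adj A ** B = 0" using HG by (simp add: M' supp_M supp_L)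
    have "A ** adj B = cnj (inverse t) *\<^sub>C (adj U ** (M ** adj L) ** U)"
      using UV(2) unfolding A B by (simp add: adj_mult matrix_mul_assoc unitary_cancel)
    then show "A ** adj B = 0" using HG by (simp add: M' supp_M supp_L)
    show "A ** V ** proj K = A ** V"
      unfolding A using UV(2) supp_M by (simp add: matrix_mul_assoc unitary_cancel)
         (simp add: matrix_mul_assoc [symmetric] P_def)
    show "B ** V ** proj K = B ** V"
      unfolding B using UV(2) supp_L by (simp add: matrix_mul_assoc unitary_cancel)
         (simp add: matrix_mul_assoc [symmetric] P_def)
  qed
qed

section \<open>Images of rank one matrices\<close>

lemma clinear_simps:
  assumes "clinear T"
  shows "T (A + B) = T A + T B" "T (c *\<^sub>C A) = c *\<^sub>C T A" "T 0 = 0" "T (sum f I) = (\<Sum>i\<in>I. T (f i))"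
proof -
  interpret Vector_Spaces.linear cscale cscale T by (rule assms)
  show "T (A + B) = T A + T B" "T (c *\<^sub>C A) = c *\<^sub>C T A" "T 0 = 0" "T (sum f I) = (\<Sum>i\<in>I. T (f i))"
    by (rule add scale zero sum)+
qed

text \<open>Nonzero pairwise orthogonal vectors are independent, and here they lie in the span of
  the coordinate vectors indexed by \<open>K\<close>.\<close>

lemma card_orthogonal_le:
  fixes B :: "(complex^'n) set"
  assumes B: "finite B" "\<And>x. x \<in> B \<Longrightarrow> x \<noteq> 0" "\<And>x. x \<in> B \<Longrightarrow> proj K *v x = x"
    and orth: "\<And>x y. x \<in> B \<Longrightarrow> y \<in> B \<Longrightarrow> x \<noteq> y \<Longrightarrow> cdot x y = 0"
  shows "card B \<le> card K"
proof -
  have "vec.independent B"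
  proof (rule vec.independent_if_scalars_zero [OF B(1)])
    fix f x assume 0: "(\<Sum>y\<in>B. f y *s y) = 0" and x: "x \<in> B"
    have "cdot x (\<Sum>y\<in>B. f y *s y) = (\<Sum>y\<in>B. f y * cdot x y)"
      using B(1) by (induction B) (simp_all add: cdot_distrib)
    also have "\<dots> = (\<Sum>y\<in>{x}. f y * cdot x y)"
      using B(1) x orth by (intro sum.mono_neutral_right) auto
    finally show "f x = 0" using 0 B(2) [OF x] by simp
  qed
  moreover have "B \<subseteq> vec.span ((\<lambda>i. axis i 1) ` K)"
  proof
    fix x assume "x \<in> B"
    then have Kx: "proj K *v x = x" by (rule B)
    have "x = (\<Sum>i\<in>K. x $ i *s axis i 1)"
    proof (subst Kx [symmetric], subst vec_eq_iff, intro allI)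
      fix m
      show "(proj K *v x) $ m = (\<Sum>i\<in>K. x $ i *s axis i 1) $ m"
        by (simp add: axis_def if_distrib if_distribR indicator_def cong: if_cong)
    qed
    also have "\<dots> \<in> vec.span ((\<lambda>i. axis i 1) ` K)"
      by (intro vec.span_sum vec.span_scale vec.span_base) auto
    finally show "x \<in> vec.span ((\<lambda>i. axis i 1) ` K)" .
  qed
  ultimately have "card B \<le> card ((\<lambda>i. axis i (1 :: complex)) ` K :: (complex^'n) set)"
    using vec.independent_span_bound [of "(\<lambda>i. axis i 1) ` K" B] by auto
  also have "\<dots> \<le> card K" by (rule card_image_le) simp
  finally show ?thesis .
qed

text \<open>The component of \<open>h\<close> orthogonal to \<open>g j\<close> is orthogonal to the
  whole family. Were it nonzero, it would enlarge the family beyond the dimension of the range of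
  the projection.\<close>

lemma orthogonal_family_complement:
  fixes g :: "'n::finite \<Rightarrow> complex^'n"
  assumes g: "\<And>i. i \<in> K \<Longrightarrow> g i \<noteq> 0" "\<And>i. i \<in> K \<Longrightarrow> proj K *v g i = g i"
    and orth: "\<And>i j. i \<in> K \<Longrightarrow> j \<in> K \<Longrightarrow> i \<noteq> j \<Longrightarrow> cdot (g i) (g j) = 0"
    and h: "proj K *v h = h" "\<And>i. i \<in> K \<Longrightarrow> i \<noteq> j \<Longrightarrow> cdot (g i) h = 0" and j: "j \<in> K"
  shows "\<exists>c. h = c *s g j"
proof -
  define c where "c = cdot (g j) h / cdot (g j) (g j)"
  define r where "r = h - c *s g j"
  have gr: "cdot (g i) r = 0" if "i \<in> K" for i
    using that h(2) [OF that] orth [OF that j] g(1) [OF j]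
    by (cases "i = j") (simp_all add: r_def cdot_distrib c_def)
  have "r = 0"
  proof (rule ccontr)
    assume "r \<noteq> 0"
    have inj: "inj_on g K" using g(1) orth by (metis cdot_self_eq_0_iff inj_onI)
    have "r \<notin> g ` K" using gr \<open>r \<noteq> 0\<close> by (metis cdot_self_eq_0_iff imageE)
    then have "card (insert r (g ` K)) = Suc (card K)"
      by (simp add: card_image [OF inj])
    moreover have "card (insert r (g ` K)) \<le> card K"
    proof (rule card_orthogonal_le)
      show "proj K *v x = x" if "x \<in> insert r (g ` K)" for x
        using that g(2) h(1) j by (auto simp: r_def matrix_vector_mult_diff_distrib vec_smult_mult)
      show "cdot x y = 0" if "x \<in> insert r (g ` K)" "y \<in> insert r (g ` K)" "x \<noteq> y" for x y
        using that orth gr by (auto, metis cnj_cdot complex_cnj_zero)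
    qed (use g(1) \<open>r \<noteq> 0\<close> in auto)
    ultimately show False by simp
  qed
  then show ?thesis by (auto simp: r_def)
qed

text \<open>Rank at most one: the zero matrix is included, which makes the notion stable under all
  scalings.\<close>

definition rank1 :: "complex^'n^'m \<Rightarrow> bool"
  where "rank1 A \<longleftrightarrow> (\<exists>x y. A = outer x y)"

text \<open>The first equation says that the column spaces are orthogonal, the second that the row
  spaces are.\<close>

definition orthogonal_matrices :: "complex^'n^'m \<Rightarrow> complex^'n^'m \<Rightarrow> bool"
  where "orthogonal_matrices A B \<longleftrightarrow> adj A ** B = 0 \<and> A ** adj B = 0"

lemma orthogonal_matrices_0 [simp]: "orthogonal_matrices 0 B" "orthogonal_matrices A 0"
  by (simp_all add: orthogonal_matrices_def)

lemma orthogonal_matrices_cscale: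
  "orthogonal_matrices A B \<Longrightarrow> orthogonal_matrices (c *\<^sub>C A) (d *\<^sub>C B)"
  by (simp add: orthogonal_matrices_def)

lemma rank1_cscale: "rank1 A \<Longrightarrow> rank1 (c *\<^sub>C A)"
proof -
  have "c *\<^sub>C outer x y = outer (c *s x) y" for x y by (simp add: vec_eq_iff)
  then show "rank1 A \<Longrightarrow> rank1 (c *\<^sub>C A)" unfolding rank1_def by metis
qed

lemma mult_adj_component: "(A ** adj B) $ a $ b = cdot (B $ b) (A $ a)"
  by (simp add: matrix_matrix_mult_def cdot_def mult.commute)

lemma rank1_if_proportional_rows:
  assumes "\<And>a. \<exists>c. A $ a = c *s g"
  shows "rank1 A"
proof -
  obtain c where "A $ a = c a *s g" for a using assms by metis
  then have "A = outer (\<chi> a. c a) (\<chi> b. cnj (g $ b))" by (simp add: vec_eq_iff)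
  then show ?thesis unfolding rank1_def by blast
qed

lemma proj_rows:
  assumes "A ** proj K = A"
  shows "proj K *v (A $ a) = A $ a"
proof -
  have "A $ a $ b = A $ a $ b * indicator K b" for b
    using assms by (metis mult_diagm_component)
  then show ?thesis by (simp add: vec_eq_iff mult.commute)
qed

text \<open>Diagonal matrices with disjoint supports inside \<open>K\<close> have additive norms
  under every relative phase, since their norms are sums of moduli. \<open>T\<close> carries this
  over to the images, to which \<open>additive_phases_imp_orthogonal\<close> applies.\<close>

lemma additive_images:
  fixes T :: "complex^'n^'n \<Rightarrow> complex^'n^'n" and K :: "'n set" and a b :: "'n \<Rightarrow> complex"
  assumes T: "clinear T" "inj T"
    and pres: "\<And>A B. ky_fan_norm k (A + B) = ky_fan_norm k A + ky_fan_norm k B \<Longrightarrow>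
      ky_fan_norm k (T A + T B) = ky_fan_norm k (T A) + ky_fan_norm k (T B)"
    and K: "card K = k" and XY: "unitary_matrix X" "unitary_matrix Y"
    and ab: "\<And>i. i \<notin> K \<Longrightarrow> a i = 0" "\<And>i. i \<notin> K \<Longrightarrow> b i = 0" "\<And>i. a i = 0 \<or> b i = 0"
    and nz: "a p \<noteq> 0" "b q \<noteq> 0"
  defines "A \<equiv> T (X ** diagm a ** Y)" and "B \<equiv> T (X ** diagm b ** Y)"
  obtains V where "unitary_matrix V" "orthogonal_matrices A B"
    "A ** V ** proj K = A ** V" "B ** V ** proj K = B ** V"
proof -
  have k: "k \<le> CARD('n)" using K by (metis card_mono finite subset_UNIV)
  have "K \<noteq> {}" using ab nz by blast
  have T0: "T M = 0 \<Longrightarrow> M = 0" for M using T(2) clinear_simps(3) [OF T(1)] by (metis injD)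
  have "diagm a \<noteq> 0" "diagm b \<noteq> 0" using nz by (auto simp: vec_eq_iff)
  then have "A \<noteq> 0" "B \<noteq> 0"
    unfolding A_def B_def using T0 unitary_eq_0_iff [OF XY] by blast+
  moreover have "ky_fan_norm k (A + t *\<^sub>C B) = ky_fan_norm k A + ky_fan_norm k B" if t: "cmod t = 1" for t
  proof -
    have sum: "X ** diagm a ** Y + t *\<^sub>C (X ** diagm b ** Y) = X ** diagm (\<lambda>i. a i + t * b i) ** Y"
    proof -
      have "diagm (\<lambda>i. a i + t * b i) = diagm a + t *\<^sub>C diagm b" by (simp add: vec_eq_iff)
      then show ?thesis by (simp add: matrix_add_ldistrib matrix_add_rdistrib)
    qed
    have scaled: "t *\<^sub>C (X ** diagm b ** Y) = X ** diagm (\<lambda>i. t * b i) ** Y"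
    proof -
      have "diagm (\<lambda>i. t * b i) = t *\<^sub>C diagm b" by (simp add: vec_eq_iff)
      then show ?thesis by simp
    qed
    have "cmod (a i + t * b i) = cmod (a i) + cmod (t * b i)" for i using ab(3) [of i] by auto
    then have "ky_fan_norm k (X ** diagm a ** Y + t *\<^sub>C (X ** diagm b ** Y)) =
        ky_fan_norm k (X ** diagm a ** Y) + ky_fan_norm k (t *\<^sub>C (X ** diagm b ** Y))"
      unfolding sum unfolding scaled
      using ab by (simp add: ky_fan_norm_diagm [OF XY K] sum.distrib)
    from pres [OF this] show ?thesis
      using t by (simp add: A_def B_def clinear_simps [OF T(1)] ky_fan_norm_cscale [OF k])
  qed
  ultimately show ?thesis
    using additive_phases_imp_orthogonal [OF K \<open>K \<noteq> {}\<close>] that unfolding orthogonal_matrices_def by metis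
qed

text \<open>The rows of the \<open>k\<close> images, after multiplication by a common
  \<open>V\<close>, lie in a space of dimension \<open>k\<close>. Rows of different images are
  orthogonal and every image has a nonzero row, so each image leaves room for just one row
  direction.\<close>

lemma image_matrix_unit:
  fixes T :: "complex^'n^'n \<Rightarrow> complex^'n^'n"
  assumes k: "1 < k" "k \<le> CARD('n)" and T: "clinear T" "inj T"
    and pres: "\<And>A B. ky_fan_norm k (A + B) = ky_fan_norm k A + ky_fan_norm k B \<Longrightarrow>
      ky_fan_norm k (T A + T B) = ky_fan_norm k (T A) + ky_fan_norm k (T B)"
    and XY: "unitary_matrix X" "unitary_matrix Y" and "i \<noteq> j"
  defines "E \<equiv> \<lambda>i. T (X ** proj {i} ** Y)"
  shows "orthogonal_matrices (E i) (E j)" "rank1 (E j)"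
proof -
  obtain K where K: "{i, j} \<subseteq> K" "card K = k"
    using exists_subset_between [of "{i, j}" k UNIV] k \<open>i \<noteq> j\<close> by auto
  have orth: "orthogonal_matrices (E p) (E q)" if "p \<in> K" "q \<in> K" "p \<noteq> q" for p q
    by (rule additive_images [OF T pres K(2) XY, of "indicator {p}" "indicator {q}" p q])
       (use that in \<open>auto simp: E_def indicator_def\<close>)
  show "orthogonal_matrices (E i) (E j)" using orth K(1) \<open>i \<noteq> j\<close> by auto
  \<comment> \<open>Pairing \<open>E i\<close> with the sum of all the other images provides one
    \<open>V\<close> valid for every index in \<open>K\<close>; pairing the images two at a time
    could give a different \<open>V\<close> for each pair.\<close>
  define J where "J = K - {i}"
  obtain V where V: "unitary_matrix V"
    "T (X ** proj J ** Y) ** V ** proj K = T (X ** proj J ** Y) ** V" "E i ** V ** proj K = E i ** V"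
    by (rule additive_images [OF T pres K(2) XY, of "indicator J" "indicator {i}" j i])
       (use K(1) \<open>i \<noteq> j\<close> in \<open>auto simp: E_def J_def indicator_def\<close>)
  have S: "T (X ** proj J ** Y) = (\<Sum>p\<in>J. E p)"
  proof -
    have "proj J = (\<Sum>p\<in>J. proj {p})"
      by (auto simp: vec_eq_iff indicator_def)
    moreover have "X ** (\<Sum>p\<in>J. f p) ** Y = (\<Sum>p\<in>J. X ** f p ** Y)" for f
      by (induction J rule: infinite_finite_induct) (simp_all add: matrix_add_ldistrib matrix_add_rdistrib)
    ultimately show ?thesis by (simp add: E_def clinear_simps [OF T(1)])
  qed
  have supp: "E p ** V ** proj K = E p ** V" if "p \<in> K" for p
  proof (cases "p = i")
    case False
    then have p: "p \<in> J" using that by (simp add: J_def)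
    \<comment> \<open>Orthogonality turns E_p^* times the sum into E_p^* E_p. As the sum annihilates
      \<open>D\<close>, so does E_p^* E_p, and hence E_p.\<close>
    define D where "D = V - V ** proj K"
    have "adj (E p) ** (\<Sum>q\<in>J. E q) = (\<Sum>q\<in>J. adj (E p) ** E q)"
      by (induction J rule: infinite_finite_induct) (simp_all add: matrix_add_ldistrib)
    also have "\<dots> = (\<Sum>q\<in>{p}. adj (E p) ** E q)"
      by (rule sum.mono_neutral_right) (use p orth in \<open>auto simp: J_def orthogonal_matrices_def\<close>)
    finally have "adj (E p) ** E p = adj (E p) ** T (X ** proj J ** Y)" by (simp add: S)
    moreover have "T (X ** proj J ** Y) ** D = 0"
      using V(2) by (simp add: D_def matrix_diff_ldistrib matrix_mul_assoc)
    ultimately have "adj (E p) ** E p ** D = 0" by (simp add: matrix_mul_assoc [symmetric])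
    then have "adj (E p ** D) ** (E p ** D) = 0"
      by (simp add: adj_mult matrix_mul_assoc [symmetric])
    then have "E p ** D = 0" by (rule adj_mult_self_eq_0)
    then show ?thesis by (simp add: D_def matrix_diff_ldistrib matrix_mul_assoc)
  qed (simp add: V(3))
  define F where "F p = E p ** V" for p
  have F: "F p ** proj K = F p" if "p \<in> K" for p using supp [OF that] by (simp add: F_def)
  have F_orth: "cdot (F q $ b) (F p $ a) = 0" if "p \<in> K" "q \<in> K" "p \<noteq> q" for p q a b
  proof -
    have "F p ** adj (F q) = E p ** adj (E q)"
      using V(1) by (simp add: F_def adj_mult matrix_mul_assoc unitary_cancel)
    then show ?thesis
      using orth [OF that] mult_adj_component [of "F p" "F q" a b] by (simp add: orthogonal_matrices_def)
  qed
  have F_nz: "\<exists>a. F p $ a \<noteq> 0" for p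
  proof (rule ccontr)
    assume "\<not> (\<exists>a. F p $ a \<noteq> 0)"
    then have "F p = 0" by (simp add: vec_eq_iff)
    then have "E p = 0" using V(1) unitary_cancel(5) [OF V(1), of "E p"] by (simp add: F_def)
    then have "X ** proj {p} ** Y = 0"
      using T(2) clinear_simps(3) [OF T(1)] by (metis E_def injD)
    then have "proj {p} = (0 :: complex^'n^'n)" using unitary_eq_0_iff [OF XY] by blast
    then have "proj {p} $ p $ p = (0 :: complex)" by (metis zero_index)
    then show False by simp
  qed
  then obtain r where r: "F p $ r p \<noteq> 0" for p by metis
  have "\<exists>c. F j $ a = c *s F j $ r j" for a
  proof (rule orthogonal_family_complement [of K "\<lambda>p. F p $ r p"])
    show "j \<in> K" using K by simp
  qed (use r F F_orth K in \<open>auto intro: proj_rows\<close>)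
  then have "rank1 (F j)" by (rule rank1_if_proportional_rows)
  then obtain x y where "F j = outer x y" by (auto simp: rank1_def)
  then have "E j = outer x y ** adj V" using unitary_cancel(5) [OF V(1), of "E j"] by (simp add: F_def)
  then show "rank1 (E j)" by (auto simp: rank1_def outer_mult)
qed

lemma axis_nth: "axis k x $ i = (if i = k then x else 0)"
  by (simp add: axis_def)

section \<open>Linear maps preserving rank one matrices and orthogonality\<close>

text \<open>A reflection along x - y with a suitable phase. The sign -1 alone would not suffice,
  since <x - y, x> need not be real.\<close>

lemma ex_unitary_move:
  assumes eq: "cdot x x = cdot y y"
  obtains U where "unitary_matrix U" "U *v x = y" "\<And>z. cdot x z = 0 \<Longrightarrow> cdot y z = 0 \<Longrightarrow> U *v z = z"
proof (cases "x = y")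
  case True
  then show ?thesis using that [of "mat 1"] by simp
next
  case False
  define r where "r = x - y"
  define n where "n = cdot x x"
  define w where "w = cdot y x"
  have n: "cnj n = n" "cdot y y = n" and w: "cdot x y = cnj w"
    by (simp_all add: n_def w_def cnj_cdot eq)
  have rr: "cdot r r = 2 * n - w - cnj w" and rx: "cdot r x = n - w"
    by (simp_all add: r_def cdot_distrib n w flip: n_def w_def)
  have "cdot r r \<noteq> 0" using False by (simp add: r_def)
  then have nw: "n - w \<noteq> 0" using n(1) rr by (auto simp: algebra_simps)
  \<comment> \<open>The component of \<open>x\<close> along \<open>r\<close> must be changed by
    exactly -r, that is (t - 1)(n - w) = -<r, r>; with <r, r> = (n - w) + cnj (n - w) this
    determines t.\<close>
  define t where "t = - cnj (n - w) / (n - w)"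
  have "cmod t = 1" using nw by (simp add: t_def norm_divide flip: complex_cnj_diff)
  then have "unitary_matrix (phase_refl r t)" by (rule unitary_phase_refl)
  moreover have "(t - 1) / cdot r r * cdot r x = - 1"
  proof -
    have "(t - 1) * (n - w) = - cdot r r" using nw n(1) by (simp add: t_def rr field_simps)
    then show ?thesis using \<open>cdot r r \<noteq> 0\<close> by (simp add: rx)
  qed
  then have "phase_refl r t *v x = x + (- 1) *s r"
    by (simp add: phase_refl_def matrix_vector_mult_add_rdistrib cscale_mult_vec outer_mult_vec)
  then have "phase_refl r t *v x = y" by (simp add: r_def vec_eq_iff)
  moreover have "phase_refl r t *v z = z" if "cdot x z = 0" "cdot y z = 0" for z
    using that by (intro phase_refl_fix) (simp add: r_def cdot_distrib)
  ultimately show ?thesis using that by blast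
qed

lemma ex_unitary_columns:
  assumes "cdot x x = 1" "cdot u u = 1" "cdot x u = 0" "i \<noteq> j"
  obtains X where "unitary_matrix X" "X *v axis i 1 = x" "X *v axis j 1 = u"
proof -
  obtain U where U: "unitary_matrix U" "U *v axis i 1 = x"
    using ex_unitary_move [of "axis i 1" x] assms(1) by auto
  define u' where "u' = adj U *v u"
  have "cdot u' u' = 1" using U(1) assms(2) by (simp add: u'_def cdot_unitary)
  moreover have "cdot u' (axis i 1) = 0"
    using assms(3) cnj_cdot [of x u] by (simp only: u'_def cdot_adj [symmetric] U) simp
  ultimately have u': "cdot (axis j 1) (axis j 1) = cdot u' u'" "cdot u' (axis i 1) = 0"
    by simp_all
  obtain W where W: "unitary_matrix W" "W *v axis j 1 = u'"
    and W_fix: "\<And>z. cdot (axis j 1) z = 0 \<Longrightarrow> cdot u' z = 0 \<Longrightarrow> W *v z = z"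
    using ex_unitary_move [OF u'(1)] by blast
  \<comment> \<open>The second move leaves the first column alone because e_i is orthogonal to both
    e_j and \<open>u'\<close>.\<close>
  have W_i: "W *v axis i 1 = axis i 1"
    by (rule W_fix [OF _ u'(2)]) (use assms(4) in \<open>simp add: axis_nth\<close>)
  have "U *v u' = u" using U(1) by (simp add: u'_def unitary_cancel)
  then show ?thesis
    using that [of "U ** W"] U W W_i by (simp add: unitary_mult matrix_vector_mul_assoc [symmetric])
qed

lemma proj_singleton: "proj {i} = outer (axis i 1) (axis i 1)"
  by (simp add: vec_eq_iff axis_nth)

lemma outer_as_matrix_unit:
  assumes "X *v axis i 1 = x" "Y *v axis i 1 = y"
  shows "X ** proj {i} ** adj Y = outer x y"
  by (simp add: proj_singleton mult_outer outer_mult assms)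

lemma outer_smult: "outer (c *s x) (d *s y) = (c * cnj d) *\<^sub>C outer x y"
  by (simp add: vec_eq_iff)

lemma ex_unit_vector:
  assumes "x \<noteq> 0"
  obtains c x' where "x = c *s x'" "cdot x' x' = 1" "c \<noteq> 0"
proof -
  define n where "n = Re (cdot x x)"
  have n: "n > 0" "cdot x x = of_real n"
    using cdot_self_real [of x] assms by (simp_all add: n_def complex_eq_iff)
  define x' where "x' = of_real (1 / sqrt n) *s x"
  have "cdot x' x' = 1"
    using n by (simp add: x'_def of_real_mult [symmetric] del: of_real_mult)
  moreover have "x = of_real (sqrt n) *s x'"
    using n by (simp add: x'_def)
  ultimately show ?thesis using that n(1) by fastforce
qed

text \<open>This extracts from the norm condition what the classification of \<open>T\<close> up to
  unitary factors and transposition relies on.\<close>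

definition rank1_orthogonal_preserving :: "(complex^'n^'n \<Rightarrow> complex^'n^'n) \<Rightarrow> bool"
  where "rank1_orthogonal_preserving T \<longleftrightarrow> clinear T \<and> inj T \<and> (\<forall>x y. rank1 (T (outer x y))) \<and>
    (\<forall>x y u v. cdot x u = 0 \<longrightarrow> cdot y v = 0 \<longrightarrow> orthogonal_matrices (T (outer x y)) (T (outer u v)))"

text \<open>After scaling, orthogonal vector pairs become columns of unitary matrices, so
  \<open>image_matrix_unit\<close> with varying \<open>X\<close> and \<open>Y\<close> reaches all
  rank one matrices and all orthogonal pairs of them.\<close>

lemma additive_preserving_imp_rank1_orthogonal_preserving:
  fixes T :: "complex^'n^'n \<Rightarrow> complex^'n^'n"
  assumes k: "1 < k" "k \<le> CARD('n)" and T: "clinear T" "inj T"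
    and pres: "\<And>A B. ky_fan_norm k (A + B) = ky_fan_norm k A + ky_fan_norm k B \<Longrightarrow>
      ky_fan_norm k (T A + T B) = ky_fan_norm k (T A) + ky_fan_norm k (T B)"
  shows "rank1_orthogonal_preserving T"
proof -
  note unit = image_matrix_unit [OF k T pres]
  note lin = clinear_simps [OF T(1)]
  obtain i j :: 'n where ij: "i \<noteq> j"
  proof (rule ccontr)
    assume "\<not> thesis"
    then have "UNIV = {undefined :: 'n}" using that by auto
    then have "CARD('n) = 1" by (metis card_1_singleton_iff One_nat_def)
    then show False using k by simp
  qed
  have "rank1 (T (outer x y))" for x y
  proof (cases "x = 0 \<or> y = 0")
    case True
    have "rank1 (0 :: complex^'n^'n)" unfolding rank1_def by (metis outer_zero(1))
    with True show ?thesis by (auto simp: lin)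
  next
    case False
    then obtain c x' where x: "x = c *s x'" "cdot x' x' = 1" using ex_unit_vector [of x] by blast
    from False obtain d y' where y: "y = d *s y'" "cdot y' y' = 1" using ex_unit_vector [of y] by blast
    obtain X where X: "unitary_matrix X" "X *v axis j 1 = x'"
      using ex_unitary_move [of "axis j 1" x'] x(2) by auto
    obtain Y where Y: "unitary_matrix Y" "Y *v axis j 1 = y'"
      using ex_unitary_move [of "axis j 1" y'] y(2) by auto
    have "rank1 (T (X ** proj {j} ** adj Y))" using X(1) Y(1) by (intro unit(2) [OF _ _ _ ij]) auto
    then show ?thesis
      unfolding outer_as_matrix_unit [OF X(2) Y(2)] by (simp add: x(1) y(1) outer_smult lin rank1_cscale)
  qed
  moreover have "orthogonal_matrices (T (outer x y)) (T (outer u v))" if xu: "cdot x u = 0" and yv: "cdot y v = 0" for x y u v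
  proof (cases "x = 0 \<or> y = 0 \<or> u = 0 \<or> v = 0")
    case True
    then show ?thesis by (auto simp: lin)
  next
    case False
    then obtain c x' where x: "x = c *s x'" "cdot x' x' = 1" "c \<noteq> 0" using ex_unit_vector [of x] by blast
    from False obtain d y' where y: "y = d *s y'" "cdot y' y' = 1" "d \<noteq> 0" using ex_unit_vector [of y] by blast
    from False obtain e u' where u: "u = e *s u'" "cdot u' u' = 1" "e \<noteq> 0" using ex_unit_vector [of u] by blast
    from False obtain f v' where v: "v = f *s v'" "cdot v' v' = 1" "f \<noteq> 0" using ex_unit_vector [of v] by blast
    have xu': "cdot x' u' = 0" and yv': "cdot y' v' = 0" using xu yv x y u v by auto
    obtain X where X: "unitary_matrix X" "X *v axis i 1 = x'" "X *v axis j 1 = u'"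
      by (rule ex_unitary_columns [OF x(2) u(2) xu' ij])
    obtain Y where Y: "unitary_matrix Y" "Y *v axis i 1 = y'" "Y *v axis j 1 = v'"
      by (rule ex_unitary_columns [OF y(2) v(2) yv' ij])
    have "orthogonal_matrices (T (X ** proj {i} ** adj Y)) (T (X ** proj {j} ** adj Y))"
      using X(1) Y(1) by (intro unit(1) [OF _ _ _ ij]) auto
    then show ?thesis
      unfolding outer_as_matrix_unit [OF X(2) Y(2)] outer_as_matrix_unit [OF X(3) Y(3)]
      by (simp add: x(1) y(1) u(1) v(1) outer_smult lin orthogonal_matrices_cscale)
  qed
  ultimately show ?thesis using T unfolding rank1_orthogonal_preserving_def by blast
qed

lemma clinearI:
  fixes T :: "complex^'n^'m \<Rightarrow> complex^'q^'p"
  assumes "\<And>A B. T (A + B) = T A + T B" "\<And>c A. T (c *\<^sub>C A) = c *\<^sub>C T A"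
  shows "clinear T"
  by (simp add: Vector_Spaces.linear_iff vector_space_cscale assms)

lemma preserving_unitary:
  assumes "rank1_orthogonal_preserving T" and UV: "unitary_matrix U" "unitary_matrix V"
  shows "rank1_orthogonal_preserving (\<lambda>X. U ** T X ** V)"
proof -
  note T = assms(1) [unfolded rank1_orthogonal_preserving_def]
  have "clinear (\<lambda>X. U ** T X ** V)"
    by (rule clinearI) (simp_all add: clinear_simps [OF T [THEN conjunct1]] matrix_add_ldistrib matrix_add_rdistrib)
  moreover have "inj (\<lambda>X. U ** T X ** V)"
  proof (rule injI)
    fix X Y assume "U ** T X ** V = U ** T Y ** V"
    then have "adj U ** (U ** T X ** V ** adj V) = adj U ** (U ** T Y ** V ** adj V)" by simp
    then show "X = Y" using T UV by (simp add: unitary_cancel inj_eq)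
  qed
  moreover have "rank1 (U ** A ** V)" if "rank1 A" for A
    using that unfolding rank1_def by (metis mult_outer outer_mult)
  moreover have "orthogonal_matrices (U ** A ** V) (U ** B ** V)" if "orthogonal_matrices A B" for A B
  proof -
    have "adj (U ** A ** V) ** (U ** B ** V) = adj V ** (adj A ** B) ** V"
      using UV by (simp add: adj_mult matrix_mul_assoc unitary_cancel)
    moreover have "(U ** A ** V) ** adj (U ** B ** V) = U ** (A ** adj B) ** adj U"
      using UV by (simp add: adj_mult matrix_mul_assoc unitary_cancel)
    ultimately show ?thesis using that by (simp add: orthogonal_matrices_def)
  qed
  ultimately show ?thesis using T unfolding rank1_orthogonal_preserving_def by blast
qed

lemma transpose_add: "transpose (A + B) = transpose A + transpose B"
  and transpose_cscale: "transpose (c *\<^sub>C D) = c *\<^sub>C transpose D"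
  by (simp_all add: transpose_def vec_eq_iff)

lemma preserving_transpose:
  assumes "rank1_orthogonal_preserving T"
  shows "rank1_orthogonal_preserving (\<lambda>X. transpose (T X))"
proof -
  note T = assms(1) [unfolded rank1_orthogonal_preserving_def]
  have "clinear (\<lambda>X. transpose (T X))"
    by (rule clinearI) (simp_all add: clinear_simps [OF T [THEN conjunct1]] transpose_add transpose_cscale)
  moreover have "inj (\<lambda>X. transpose (T X))" using T by (simp add: inj_def)
  moreover have "rank1 (transpose A)" if "rank1 A" for A :: "complex^'n^'n"
  proof -
    have "transpose (outer x y) = outer (\<chi> i. cnj (y $ i)) (\<chi> i. cnj (x $ i))" for x y :: "complex^'n"
      by (simp add: vec_eq_iff transpose_def)
    then show ?thesis using that unfolding rank1_def by metis
  qed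
  moreover have "orthogonal_matrices (transpose A) (transpose B)" if "orthogonal_matrices A B" for A B :: "complex^'n^'n"
  proof -
    have at: "adj (transpose A) = transpose (adj A)" for A :: "complex^'n^'n"
      by (simp add: vec_eq_iff transpose_def)
    have "adj (transpose A) ** transpose B = transpose (adj (A ** adj B))"
      by (simp add: at adj_mult matrix_transpose_mul)
    moreover have "transpose A ** adj (transpose B) = transpose (adj (adj A ** B))"
      by (simp add: at adj_mult matrix_transpose_mul)
    moreover have "transpose 0 = (0 :: complex^'n^'n)" by (simp add: vec_eq_iff transpose_def)
    ultimately show ?thesis using that by (simp add: orthogonal_matrices_def)
  qed
  ultimately show ?thesis using T unfolding rank1_orthogonal_preserving_def by blast
qed

section \<open>Normal form of a preserver on the matrix units\<close>

abbreviation unit_matrix :: "'n \<Rightarrow> 'n \<Rightarrow> complex^'n^'n"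
  where "unit_matrix i j \<equiv> outer (axis i 1) (axis j 1)"

lemma unit_matrix_component: "unit_matrix i j $ a $ b = (if a = i \<and> b = j then 1 else 0)"
  by (simp add: axis_nth)

lemma matrix_sum_units: "X = (\<Sum>i\<in>UNIV. \<Sum>j\<in>UNIV. X $ i $ j *\<^sub>C unit_matrix i j)"
proof -
  have "(\<Sum>i\<in>UNIV. \<Sum>j\<in>UNIV. X $ i $ j *\<^sub>C unit_matrix i j) $ a $ b = X $ a $ b" for a b
  proof -
    have "(\<Sum>j\<in>UNIV. X $ i $ j *\<^sub>C unit_matrix i j) $ a $ b = (if i = a then X $ i $ b else 0)" for i
      by (cases "i = a") (simp_all add: unit_matrix_component if_distrib del: outer_component cong: if_cong)
    then show ?thesis by simp
  qed
  then show ?thesis by (simp add: vec_eq_iff)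
qed

lemma matrix_eqI: "(\<And>a b. A $ a $ b = B $ a $ b) \<Longrightarrow> A = B"
  by (simp add: vec_eq_iff)

lemma rank1_minor: "rank1 A \<Longrightarrow> A $ a $ b * A $ c $ d = A $ a $ d * A $ c $ b"
  by (auto simp: rank1_def)

lemma orthogonal_outer:
  assumes "orthogonal_matrices (outer a b) (outer c d)" "a \<noteq> 0" "b \<noteq> 0" "c \<noteq> 0" "d \<noteq> 0"
  shows "cdot a c = 0" "cdot b d = 0"
proof -
  have "outer b d \<noteq> 0" "outer a c \<noteq> 0" using assms by (auto simp: vec_eq_iff)
  moreover have "cdot a c *\<^sub>C outer b d = 0" "cdot b d *\<^sub>C outer a c = 0"
    using assms(1) by (simp_all add: orthogonal_matrices_def outer_mult_outer)
  ultimately show "cdot a c = 0" "cdot b d = 0" by (auto simp: vec_eq_iff)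
qed

lemma unitary_columns:
  assumes "\<And>i j. cdot (a i) (a j) = (if i = j then 1 else 0)"
  obtains P where "unitary_matrix P" "\<And>i. P *v axis i 1 = a i"
proof
  let ?P = "\<chi> m i. a i $ m"
  show "unitary_matrix ?P"
    using assms by (simp add: unitary_iff vec_eq_iff matrix_matrix_mult_def cdot_def mat_def)
  show "?P *v axis i 1 = a i" for i by (simp add: vec_eq_iff mult_vec_axis)
qed

text \<open>The images of the diagonal units are nonzero, of rank one and pairwise orthogonal, so
  their normalised column and row vectors form two orthonormal bases, which the unitary factors move
  to the coordinate basis.\<close>

lemma preserving_normalise_diagonal:
  fixes T :: "complex^'n^'n \<Rightarrow> complex^'n^'n"
  assumes "rank1_orthogonal_preserving T"
  obtains U V c where "unitary_matrix U" "unitary_matrix V"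
    "\<And>i. U ** T (unit_matrix i i) ** V = c i *\<^sub>C unit_matrix i i" "\<And>i. c i \<noteq> 0"
proof -
  note T = assms [unfolded rank1_orthogonal_preserving_def]
  have ex: "\<exists>c a b. T (unit_matrix i i) = c *\<^sub>C outer a b \<and> c \<noteq> 0 \<and> cdot a a = 1 \<and> cdot b b = 1" for i
  proof -
    obtain x y where xy: "T (unit_matrix i i) = outer x y" using T unfolding rank1_def by metis
    have "unit_matrix i i \<noteq> 0" by (auto simp: vec_eq_iff axis_nth)
    then have "T (unit_matrix i i) \<noteq> 0" using T clinear_simps(3) [of T] by (metis injD)
    then have "x \<noteq> 0" "y \<noteq> 0" using xy by auto
    obtain c a where a: "x = c *s a" "cdot a a = 1" "c \<noteq> 0" using ex_unit_vector [OF \<open>x \<noteq> 0\<close>] by blast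
    obtain d b where b: "y = d *s b" "cdot b b = 1" "d \<noteq> 0" using ex_unit_vector [OF \<open>y \<noteq> 0\<close>] by blast
    have "T (unit_matrix i i) = (c * cnj d) *\<^sub>C outer a b" by (simp only: xy a(1) b(1) outer_smult)
    moreover have "c * cnj d \<noteq> 0" using a b by simp
    ultimately show ?thesis using a b by blast
  qed
  then obtain c a b where cab: "T (unit_matrix i i) = c i *\<^sub>C outer (a i) (b i)" "c i \<noteq> 0"
    "cdot (a i) (a i) = 1" "cdot (b i) (b i) = 1" for i
    by metis
  have orth: "cdot (a i) (a j) = 0 \<and> cdot (b i) (b j) = 0" if "i \<noteq> j" for i j
  proof -
    have "orthogonal_matrices (T (unit_matrix i i)) (T (unit_matrix j j))"
      using T that by (simp add: axis_nth)
    then have "orthogonal_matrices (inverse (c i) *\<^sub>C c i *\<^sub>C outer (a i) (b i)) (inverse (c j) *\<^sub>C c j *\<^sub>C outer (a j) (b j))"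
      unfolding cab by (rule orthogonal_matrices_cscale)
    then have "orthogonal_matrices (outer (a i) (b i)) (outer (a j) (b j))" by (simp add: cab)
    moreover have "a i \<noteq> 0" "b i \<noteq> 0" for i using cab(3,4) [of i] by auto
    ultimately show ?thesis using orthogonal_outer by blast
  qed
  obtain P where P: "unitary_matrix P" "\<And>i. P *v axis i 1 = a i"
    by (rule unitary_columns [of a]) (use orth cab(3) in auto)
  obtain Q where Q: "unitary_matrix Q" "\<And>i. Q *v axis i 1 = b i"
    by (rule unitary_columns [of b]) (use orth cab(4) in auto)
  show ?thesis
  proof
    show "unitary_matrix (adj P)" "unitary_matrix Q" using P Q by simp_all
    have "adj P *v a i = axis i 1" "adj Q *v b i = axis i 1" for i
      using P Q by (simp_all add: unitary_cancel flip: P(2) Q(2))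
    then show "adj P ** T (unit_matrix i i) ** Q = c i *\<^sub>C unit_matrix i i" for i
      by (simp add: cab mult_outer outer_mult)
    show "c i \<noteq> 0" for i by (rule cab)
  qed
qed

lemma outer_add: "outer (u + v) w = outer u w + outer v w" "outer w (u + v) = outer w u + outer w v"
  by (simp_all add: vec_eq_iff algebra_simps)

text \<open>Orthogonality to the remaining diagonal units confines the image of E_ij to the rows and
  columns i and j. E_ij + E_ii and E_ij + E_jj also have rank one; comparing minors makes the
  diagonal entries 0. The minor of the image itself then makes one of the two other entries 0, and
  injectivity keeps the other.\<close>

lemma preserving_off_diagonal:
  fixes T :: "complex^'n^'n \<Rightarrow> complex^'n^'n"
  assumes "rank1_orthogonal_preserving T"
    and diag: "\<And>i. T (unit_matrix i i) = c i *\<^sub>C unit_matrix i i" "\<And>i. c i \<noteq> 0"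
    and ij: "i \<noteq> j"
  shows "(a, b) \<noteq> (i, j) \<Longrightarrow> (a, b) \<noteq> (j, i) \<Longrightarrow> T (unit_matrix i j) $ a $ b = 0"
    and "T (unit_matrix i j) $ i $ j = 0 \<longleftrightarrow> T (unit_matrix i j) $ j $ i \<noteq> 0"
proof -
  note T = assms(1) [unfolded rank1_orthogonal_preserving_def]
  have lin: "clinear T" using T by blast
  define Z where "Z = T (unit_matrix i j)"
  have row_col: "Z $ l $ m = 0" "Z $ m $ l = 0" if l: "l \<noteq> i" "l \<noteq> j" for l m
  proof -
    have "orthogonal_matrices Z (T (unit_matrix l l))"
      using T l unfolding Z_def by (simp add: axis_nth)
    then have "adj Z ** unit_matrix l l = 0" "Z ** unit_matrix l l = 0"
      unfolding orthogonal_matrices_def diag using diag(2) [of l] by (auto simp: vec_eq_iff)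
    then have "(adj Z ** unit_matrix l l) $ m $ l = 0" "(Z ** unit_matrix l l) $ m $ l = 0" by simp_all
    then show "Z $ l $ m = 0" "Z $ m $ l = 0" by (simp_all add: mult_outer mult_vec_axis)
  qed
  have rank1: "rank1 Z" "rank1 (Z + c i *\<^sub>C unit_matrix i i)" "rank1 (Z + c j *\<^sub>C unit_matrix j j)"
  proof -
    show "rank1 Z" using T by (simp add: Z_def)
    have "Z + c i *\<^sub>C unit_matrix i i = T (outer (axis i 1) (axis j 1 + axis i 1))"
      by (simp add: outer_add clinear_simps [OF lin] diag Z_def)
    then show "rank1 (Z + c i *\<^sub>C unit_matrix i i)" using T by simp
    have "Z + c j *\<^sub>C unit_matrix j j = T (outer (axis i 1 + axis j 1) (axis j 1))"
      by (simp add: outer_add clinear_simps [OF lin] diag Z_def)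
    then show "rank1 (Z + c j *\<^sub>C unit_matrix j j)" using T by simp
  qed
  have minor: "Z $ i $ i * Z $ j $ j = Z $ i $ j * Z $ j $ i" using rank1_minor [OF rank1(1)] .
  have Zii: "Z $ i $ i = 0"
    using rank1_minor [OF rank1(3), of i i j j] minor ij diag(2) [of j]
    by (simp add: unit_matrix_component algebra_simps del: outer_component)
  have Zjj: "Z $ j $ j = 0"
    using rank1_minor [OF rank1(2), of i i j j] minor ij diag(2) [of i]
    by (simp add: unit_matrix_component algebra_simps del: outer_component)
  have zero: "Z $ a $ b = 0" if "(a, b) \<noteq> (i, j)" "(a, b) \<noteq> (j, i)" for a b
    using that row_col [of a b] row_col [of b a] Zii Zjj by (cases "a = i"; cases "a = j"; cases "b = i"; cases "b = j") auto
  then show "(a, b) \<noteq> (i, j) \<Longrightarrow> (a, b) \<noteq> (j, i) \<Longrightarrow> T (unit_matrix i j) $ a $ b = 0"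
    by (simp add: Z_def)
  have "unit_matrix i j $ i $ j \<noteq> 0" by simp
  then have "unit_matrix i j \<noteq> 0" by (metis zero_index)
  then have "Z \<noteq> 0" unfolding Z_def using T clinear_simps(3) [OF lin] by (metis injD)
  then obtain a b where "Z $ a $ b \<noteq> 0" by (auto simp: vec_eq_iff)
  then have "Z $ i $ j \<noteq> 0 \<or> Z $ j $ i \<noteq> 0" using zero [of a b] by auto
  then show "T (unit_matrix i j) $ i $ j = 0 \<longleftrightarrow> T (unit_matrix i j) $ j $ i \<noteq> 0"
    using minor Zii by (auto simp flip: Z_def)
qed

lemma preserving_dichotomy:
  fixes T :: "complex^'n^'n \<Rightarrow> complex^'n^'n"
  assumes "rank1_orthogonal_preserving T"
    and diag: "\<And>i. T (unit_matrix i i) = c i *\<^sub>C unit_matrix i i" "\<And>i. c i \<noteq> 0"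
  shows "(\<forall>i j. \<exists>e. T (unit_matrix i j) = e *\<^sub>C unit_matrix i j) \<or>
    (\<forall>i j. \<exists>e. T (unit_matrix i j) = e *\<^sub>C unit_matrix j i)"
proof -
  note T = assms(1) [unfolded rank1_orthogonal_preserving_def]
  have lin: "clinear T" using T by blast
  note off = preserving_off_diagonal [OF assms]
  \<comment> \<open>\<open>D i j\<close> means that the unit at (i, j) stays in place; for i
    \<noteq> j its failure means that it moves to (j, i). The steps below show that all off-diagonal
    units behave alike.\<close>
  define D where "D i j \<longleftrightarrow> T (unit_matrix i j) $ i $ j \<noteq> 0" for i j
  have nD: "T (unit_matrix i j) $ j $ i \<noteq> 0" if "\<not> D i j" "i \<noteq> j" for i j
    using that off(2) [of i j] by (simp add: D_def)
  have row: "D i l" if "D i j" "i \<noteq> j" "i \<noteq> l" for i j l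
  proof (rule ccontr)
    assume nDil: "\<not> D i l"
    then have "j \<noteq> l" using that by auto
    let ?S = "T (outer (axis i 1) (axis j 1 + axis l 1))"
    have S: "?S = T (unit_matrix i j) + T (unit_matrix i l)"
      by (simp add: outer_add clinear_simps [OF lin])
    \<comment> \<open>If E_ij stays and E_il moves to (l, i), this minor of a rank one image has a
      nonzero product on the left and zero on the right.\<close>
    have "?S $ i $ j * ?S $ l $ i = ?S $ i $ i * ?S $ l $ j"
      using T by (intro rank1_minor) blast
    then show False
      using that nD [OF nDil] \<open>j \<noteq> l\<close> unfolding S D_def by (simp add: off)
  qed
  have col: "D l j" if "D i j" "i \<noteq> j" "l \<noteq> j" for i j l
  proof (rule ccontr)
    assume nDlj: "\<not> D l j"
    then have "i \<noteq> l" using that by auto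
    let ?S = "T (outer (axis i 1 + axis l 1) (axis j 1))"
    have S: "?S = T (unit_matrix i j) + T (unit_matrix l j)"
      by (simp add: outer_add clinear_simps [OF lin])
    have "?S $ i $ j * ?S $ j $ l = ?S $ i $ l * ?S $ j $ j"
      using T by (intro rank1_minor) blast
    then show False
      using that nD [OF nDlj] \<open>i \<noteq> l\<close> unfolding S D_def by (simp add: off)
  qed
  have sym: "D j i" if "D i j" "i \<noteq> j" for i j
  proof (rule ccontr)
    \<comment> \<open>Otherwise the images of the orthogonal units E_ij and E_ji would both sit at
      position (i, j).\<close>
    assume nDji: "\<not> D j i"
    have "orthogonal_matrices (T (unit_matrix i j)) (T (unit_matrix j i))"
      using T that by (simp add: axis_nth)
    then have "(adj (T (unit_matrix i j)) ** T (unit_matrix j i)) $ j $ j = 0"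
      by (simp add: orthogonal_matrices_def)
    moreover have "(adj (T (unit_matrix i j)) ** T (unit_matrix j i)) $ j $ j =
        (\<Sum>m\<in>UNIV. cnj (T (unit_matrix i j) $ m $ j) * T (unit_matrix j i) $ m $ j)"
      by (simp add: matrix_matrix_mult_def)
    moreover have "\<dots> = (\<Sum>m\<in>{i}. cnj (T (unit_matrix i j) $ m $ j) * T (unit_matrix j i) $ m $ j)"
      by (rule sum.mono_neutral_right) (use that in \<open>auto simp: off\<close>)
    ultimately show False using that nD [OF nDji] by (simp add: D_def)
  qed
  \<comment> \<open>The path goes along row i to column q and then along that column. For q = i this
    would pass through a diagonal position, so it starts at (j, i) instead.\<close>
  have connect: "D p q" if "D i j" "i \<noteq> j" "p \<noteq> q" for i j p q
  proof (cases "q = i")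
    case True
    then show ?thesis using that col [OF sym [OF that(1,2)], of p] by auto
  next
    case False
    then show ?thesis using that col [OF row [OF that(1,2), of q], of p] by auto
  qed
  show ?thesis
  proof (cases "\<exists>i j. i \<noteq> j \<and> D i j")
    case True
    then have "D i j" if "i \<noteq> j" for i j using connect that by blast
    then have zero: "T (unit_matrix i j) $ j $ i = 0" if "i \<noteq> j" for i j
      using that off(2) [of i j] by (simp add: D_def)
    have "T (unit_matrix i j) = (T (unit_matrix i j) $ i $ j) *\<^sub>C unit_matrix i j" if "i \<noteq> j" for i j
    proof -
      have "T (unit_matrix i j) $ a $ b = (T (unit_matrix i j) $ i $ j *\<^sub>C unit_matrix i j) $ a $ b" for a b
        using that zero [OF that] off(1) [OF that, of a b]
        by (cases "a = i \<and> b = j"; cases "a = j \<and> b = i")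
           (auto simp: unit_matrix_component simp del: outer_component)
      then show ?thesis by (rule matrix_eqI)
    qed
    then show ?thesis using diag by metis
  next
    case False
    then have zero: "T (unit_matrix i j) $ i $ j = 0" if "i \<noteq> j" for i j
      using that by (auto simp: D_def)
    have "T (unit_matrix i j) = (T (unit_matrix i j) $ j $ i) *\<^sub>C unit_matrix j i" if "i \<noteq> j" for i j
    proof -
      have "T (unit_matrix i j) $ a $ b = (T (unit_matrix i j) $ j $ i *\<^sub>C unit_matrix j i) $ a $ b" for a b
        using that zero [OF that] off(1) [OF that, of a b]
        by (cases "a = i \<and> b = j"; cases "a = j \<and> b = i")
           (auto simp: unit_matrix_component simp del: outer_component)
      then show ?thesis by (rule matrix_eqI)
    qed
    then show ?thesis using diag by metis
  qed
qed

text \<open>\<open>T\<close> multiplies entries by a fixed matrix \<open>e\<close>. It remains to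
  show that the entries of \<open>e\<close> have a common modulus and that \<open>e\<close> has rank
  one; then \<open>e\<close> factors into phases depending on the row and on the column.\<close>

lemma preserving_hadamard:
  fixes T :: "complex^'n^'n \<Rightarrow> complex^'n^'n"
  assumes "rank1_orthogonal_preserving T"
    and units: "\<And>i j. \<exists>e. T (unit_matrix i j) = e *\<^sub>C unit_matrix i j"
  obtains g U V where "g > (0 :: real)" "unitary_matrix U" "unitary_matrix V" "\<And>X. T X = g *\<^sub>R (U ** X ** V)"
proof -
  note T = assms(1) [unfolded rank1_orthogonal_preserving_def]
  have lin: "clinear T" using T by blast
  obtain e where e: "T (unit_matrix i j) = e i j *\<^sub>C unit_matrix i j" for i j using units by metis
  have TX: "T X $ a $ b = e a b * X $ a $ b" for X a b
  proof -
    have "T X = T (\<Sum>i\<in>UNIV. \<Sum>j\<in>UNIV. X $ i $ j *\<^sub>C unit_matrix i j)"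
      by (simp only: matrix_sum_units [of X, symmetric])
    also have "\<dots> = (\<Sum>i\<in>UNIV. \<Sum>j\<in>UNIV. (e i j * X $ i $ j) *\<^sub>C unit_matrix i j)"
      by (simp add: clinear_simps [OF lin] e mult.commute)
    also have "\<dots> = (\<chi> i j. e i j * X $ i $ j)"
      using matrix_sum_units [of "\<chi> i j. e i j * X $ i $ j"] by simp
    finally show ?thesis by simp
  qed
  have norm_eq: "cmod (e j i) = cmod (e i i)" "cmod (e i j) = cmod (e i i)" for i j
  proof -
    have "cmod (e j i) = cmod (e i i) \<and> cmod (e i j) = cmod (e i i)"
    proof (cases "i = j")
      case False
      \<comment> \<open>With x = e_i + e_j and u = e_i - e_j, orthogonality of the images of x x^*
        and u u^* compares squared moduli within column i and within row i.\<close>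
      define x :: "complex^'n" where "x = axis i 1 + axis j 1"
      define u :: "complex^'n" where "u = axis i 1 - axis j 1"
      have vals: "x $ m = (if m = i \<or> m = j then 1 else 0)" "u $ m = (if m = i then 1 else if m = j then - 1 else 0)" for m
        using False by (auto simp: x_def u_def axis_nth)
      have "cdot x u = 0" using False by (simp add: x_def u_def cdot_distrib axis_nth)
      then have orth: "orthogonal_matrices (T (outer x x)) (T (outer u u))" using T by blast
      have "(adj (T (outer x x)) ** T (outer u u)) $ i $ i =
          (\<Sum>m\<in>UNIV. cnj (e m i * x $ m) * (e m i * u $ m))"
        by (auto simp: matrix_matrix_mult_def TX vals intro!: sum.cong)
      also have "\<dots> = (\<Sum>m\<in>{i, j}. cnj (e m i * x $ m) * (e m i * u $ m))"
        by (rule sum.mono_neutral_right) (auto simp: vals)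
      also have "\<dots> = of_real ((cmod (e i i))\<^sup>2 - (cmod (e j i))\<^sup>2)"
        using False by (simp add: vals complex_norm_square mult.commute del: of_real_power)
      finally have "(cmod (e i i))\<^sup>2 - (cmod (e j i))\<^sup>2 = 0"
        using orth by (simp add: orthogonal_matrices_def del: of_real_diff of_real_power)
      moreover have "(T (outer x x) ** adj (T (outer u u))) $ i $ i =
          (\<Sum>m\<in>UNIV. e i m * x $ m * cnj (e i m * u $ m))"
        by (auto simp: matrix_matrix_mult_def TX vals intro!: sum.cong)
      moreover have "\<dots> = (\<Sum>m\<in>{i, j}. e i m * x $ m * cnj (e i m * u $ m))"
        by (rule sum.mono_neutral_right) (auto simp: vals)
      moreover have "\<dots> = of_real ((cmod (e i i))\<^sup>2 - (cmod (e i j))\<^sup>2)"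
        using False by (simp add: vals complex_norm_square mult.commute del: of_real_power)
      moreover have "(T (outer x x) ** adj (T (outer u u))) $ i $ i = 0"
        using orth by (simp add: orthogonal_matrices_def)
      ultimately have "(cmod (e i i))\<^sup>2 = (cmod (e j i))\<^sup>2" "(cmod (e i i))\<^sup>2 = (cmod (e i j))\<^sup>2"
        by (simp_all del: of_real_power of_real_diff)
      then show ?thesis by simp
    qed simp
    then show "cmod (e j i) = cmod (e i i)" "cmod (e i j) = cmod (e i i)" by simp_all
  qed
  \<comment> \<open>An arbitrary base index, used only as a reference row and column.\<close>
  define o' :: 'n where "o' = undefined"
  define g where "g = cmod (e o' o')"
  have g: "cmod (e i j) = g" for i j
    using norm_eq(2) [of i j] norm_eq(1) [of o' i] norm_eq(2) [of o' i] by (simp add: g_def)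
  have "g \<noteq> 0"
  proof
    assume "g = 0"
    then have "T (mat 1) = 0" using g by (simp add: vec_eq_iff TX)
    then have "mat 1 = (0 :: complex^'n^'n)" using T clinear_simps(3) [OF lin] by (metis injD)
    then have "mat 1 $ o' $ o' = (0 :: complex)" by simp
    then show False by (simp add: mat_def)
  qed
  then have g0: "g > 0" by (simp add: g_def)
  \<comment> \<open>The image of the all-ones matrix is \<open>e\<close> itself, so its minors give
    e_ab e_oo = e_ao e_ob. Dividing by \<open>g\<close> in one factor and by the entry at the base
    index in the other makes both factors phases.\<close>
  define al where "al i = e i o' / g" for i
  define be where "be j = e o' j / e o' o'" for j
  have e0: "e o' o' \<noteq> 0" using \<open>g \<noteq> 0\<close> by (auto simp: g_def)
  have "rank1 (T (outer (\<chi> i. 1) (\<chi> i. 1)))" using T by blast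
  from rank1_minor [OF this] have "e a b * e o' o' = e a o' * e o' b" for a b
    by (simp add: TX)
  then have e_prod: "e a b = g * (al a * be b)" for a b
    using g0 e0 by (simp add: al_def be_def field_simps)
  have "unitary_matrix (diagm al)" "unitary_matrix (diagm be)"
    using g g0 by (auto intro!: unitary_diagm simp: al_def be_def norm_divide)
  moreover have "T X = g *\<^sub>R (diagm al ** X ** diagm be)" for X
    by (simp add: vec_eq_iff TX e_prod) (simp add: scaleR_conv_of_real mult_ac)
  ultimately show ?thesis using that g0 by blast
qed

text \<open>Unitary factors reduce to diagonal units being fixed up to scalars. In the second case
  of \<open>preserving_dichotomy\<close> the entrywise form holds for the transposed map, and
  transposing back exchanges the roles of the two unitaries.\<close>

lemma preserving_form:
  fixes T :: "complex^'n^'n \<Rightarrow> complex^'n^'n"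
  assumes "rank1_orthogonal_preserving T"
  obtains g U V where "g > (0 :: real)" "unitary_matrix U" "unitary_matrix V"
    "(\<forall>X. T X = g *\<^sub>R (U ** X ** V)) \<or> (\<forall>X. T X = g *\<^sub>R (U ** transpose X ** V))"
proof -
  obtain P Q c where PQ: "unitary_matrix P" "unitary_matrix Q"
    and diag: "\<And>i. P ** T (unit_matrix i i) ** Q = c i *\<^sub>C unit_matrix i i" "\<And>i. c i \<noteq> 0"
    using preserving_normalise_diagonal [OF assms] by blast
  define T' where "T' X = P ** T X ** Q" for X
  have T': "rank1_orthogonal_preserving T'"
    unfolding T'_def by (rule preserving_unitary [OF assms PQ])
  have T'_diag: "T' (unit_matrix i i) = c i *\<^sub>C unit_matrix i i" for i
    by (simp only: T'_def diag(1))
  have T: "T X = adj P ** T' X ** adj Q" for X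
    using PQ by (simp add: T'_def matrix_mul_assoc unitary_cancel)
  obtain g U V where gUV: "g > (0 :: real)" "unitary_matrix U" "unitary_matrix V"
    "(\<forall>X. T' X = g *\<^sub>R (U ** X ** V)) \<or> (\<forall>X. T' X = g *\<^sub>R (U ** transpose X ** V))"
  proof (cases "\<forall>i j. \<exists>e. T' (unit_matrix i j) = e *\<^sub>C unit_matrix i j")
    case True
    then show ?thesis using preserving_hadamard [OF T'] that by metis
  next
    case False
    then have "\<exists>e. T' (unit_matrix i j) = e *\<^sub>C unit_matrix j i" for i j
      using preserving_dichotomy [OF T' T'_diag diag(2)] by blast
    moreover have "transpose (unit_matrix i j) = unit_matrix j i" for i j :: 'n
      by (auto simp: vec_eq_iff transpose_def axis_nth)
    ultimately have "\<exists>e. transpose (T' (unit_matrix i j)) = e *\<^sub>C unit_matrix i j" for i j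
      by (metis transpose_cscale)
    then obtain g U V where g: "g > (0 :: real)" and UV: "unitary_matrix U" "unitary_matrix V"
      and T'_eq: "\<And>X. transpose (T' X) = g *\<^sub>R (U ** X ** V)"
      using preserving_hadamard [OF preserving_transpose [OF T']] by metis
    have "T' X = g *\<^sub>R (transpose V ** transpose X ** transpose U)" for X
      using arg_cong [OF T'_eq [of X], of transpose]
      by (simp add: transpose_scalar matrix_transpose_mul matrix_mul_assoc)
    then show ?thesis using that [OF g unitary_transpose [OF UV(2)] unitary_transpose [OF UV(1)]] by blast
  qed
  have "(\<forall>X. T X = g *\<^sub>R ((adj P ** U) ** X ** (V ** adj Q))) \<or>
      (\<forall>X. T X = g *\<^sub>R ((adj P ** U) ** transpose X ** (V ** adj Q)))"
    using gUV(4) by (auto simp: T scaleR_eq_cscale matrix_mul_assoc)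
  then show ?thesis
    using that [of g "adj P ** U" "V ** adj Q"] gUV(1-3) PQ by (simp add: unitary_mult)
qed


theorem corollary2p2:
  fixes T :: "complex^'n^'n \<Rightarrow> complex^'n^'n" and k :: nat
  assumes "1 < k" and "k \<le> CARD('n)"
    and "clinear T" and "bij T"
    and "\<And>A B. ky_fan_norm k (A + B) = ky_fan_norm k A + ky_fan_norm k B \<Longrightarrow>
      ky_fan_norm k (T A + T B) = ky_fan_norm k (T A) + ky_fan_norm k (T B)"
  shows "(\<exists>(c::complex) S. ky_fan_linear_isometry k S \<and> (\<forall>X. T X = c *\<^sub>C S X)) \<and>
    (\<exists>(\<gamma>::real) U V. \<gamma> > 0 \<and> unitary_matrix U \<and> unitary_matrix V \<and>
      ((\<forall>X. T X = \<gamma> *\<^sub>R (U ** X ** V)) \<or>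
       (\<forall>X. T X = \<gamma> *\<^sub>R (U ** transpose X ** V))))"
proof -
  have "rank1_orthogonal_preserving T"
    using assms bij_is_inj by (intro additive_preserving_imp_rank1_orthogonal_preserving) auto
  then obtain g U V where g: "g > (0 :: real)" and UV: "unitary_matrix U" "unitary_matrix V"
    and T: "(\<forall>X. T X = g *\<^sub>R (U ** X ** V)) \<or> (\<forall>X. T X = g *\<^sub>R (U ** transpose X ** V))"
    by (rule preserving_form)
  \<comment> \<open>Either form without its factor \<open>g\<close> is an isometry, so
    \<open>g\<close> itself is the scalar in the first claim.\<close>
  have "ky_fan_linear_isometry k (\<lambda>X. U ** X ** V)" "ky_fan_linear_isometry k (\<lambda>X. U ** transpose X ** V)"
    unfolding ky_fan_linear_isometry_def using assms(2) UV
    by (auto intro!: clinearI simp: matrix_add_ldistrib matrix_add_rdistrib transpose_add transpose_cscale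
        ky_fan_norm_unitary ky_fan_norm_transpose)
  then have "\<exists>(c::complex) S. ky_fan_linear_isometry k S \<and> (\<forall>X. T X = c *\<^sub>C S X)"
    using T unfolding scaleR_eq_cscale by blast
  with g UV T show ?thesis by blast
qed

end
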